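(* There is an infinitely generated Fuchsian group $\Gamma_1$ (i.e. a Fuchsian group that is not finitely generated), containing no parabolic elements, having uncountably many weak concentration points that are not conical limit points, and uncountably many conical limit points that are not geodesic separation points.
   Context: A Fuchsian group $\Gamma$ is a discrete group of Möbius transformations acting on the Poincaré disc $B^2$, and hence also on the circle at infinity $S^1=\partial B^2$. Neighborhoods of points in $S^1$ are taken to be open subsets of $S^1$. An open set $U\subseteq S^1$ can be concentrated at $p\in S^1$ if for every neighborhood $V$ of $p$ in $S^1$ there exists $\gamma\in\Gamma$ such that $p\in\gamma(U)$ and $\gamma(U)\subseteq V$. A limit point $p$ of $\Gamma$ is a weak concentration point for $\Gamma$ if there exists a connected open set in $S^1$ that can be concentrated at $p$. A limit point $p$ of $\Gamma$ is a geodesic separation point for $\Gamma$ if for every sufficiently small connected neighborhood $U$ of $p$ (i.e. there is a neighborhood $W$ of $p$ such that for every connected neighborhood $U$ of $p$ with $U\subseteq W$), either $U$ or $S^1-\overline{U}$ can be concentrated at $p$. A limit point $p$ of $\Gamma$ is a conical limit point if there is a sequence of translates $\gamma_n(0)$, $\gamma_n\in\Gamma$, of the origin $0\in B^2$ that converges to $p$ and lies within a bounded hyperbolic distance of a geodesic ray ending at $p$. *)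

theory Defs
  imports
    "HOL-Complex_Analysis.Riemann_Mapping"
    "HOL-Algebra.Bij"
    "HOL-Algebra.Generated_Groups"
begin

section \<open>Fuchsian groups acting on the closed unit disc\<close>

text \<open>
  A Moebius transformation of the Poincare disc is represented by its (extensional) restriction
  to the closed disc, so that one function carries both the action on the open disc and the
  action on the circle at infinity, and the poles outside the closed disc play no role. The
  ambient group is the library group \<^term>\<open>BijGroup (cball 0 1)\<close> of all bijections of the closed
  disc under composition. As usual for Fuchsian groups, Moebius transformations are
  orientation-preserving: they are the maps
  \<open>z \<mapsto> exp (\<i> t) (z - w) / (1 - cnj w z)\<close> with \<open>t\<close> real and \<open>norm w < 1\<close>.
\<close>

definition disc_moebius :: "(complex \<Rightarrow> complex) set" where
  "disc_moebius = {restrict (Moebius_function t w) (cball 0 1) | t w. norm w < 1}"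

text \<open>Every point of \<open>\<Gamma>\<close> is isolated for the metric of uniform convergence on the closed disc.\<close>

definition discrete_moebius :: "(complex \<Rightarrow> complex) set \<Rightarrow> bool" where
  "discrete_moebius \<Gamma> \<longleftrightarrow>
     (\<forall>f\<in>\<Gamma>. \<exists>e>0. \<forall>g\<in>\<Gamma>. (\<forall>z\<in>cball 0 1. dist (g z) (f z) < e) \<longrightarrow> g = f)"

definition fuchsian_group :: "(complex \<Rightarrow> complex) set \<Rightarrow> bool" where
  "fuchsian_group \<Gamma> \<longleftrightarrow>
     subgroup \<Gamma> (BijGroup (cball 0 1)) \<and> \<Gamma> \<subseteq> disc_moebius \<and> discrete_moebius \<Gamma>"

definition finitely_generated :: "(complex \<Rightarrow> complex) set \<Rightarrow> bool" where
  "finitely_generated \<Gamma> \<longleftrightarrow>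
     (\<exists>S. finite S \<and> S \<subseteq> \<Gamma> \<and> generate (BijGroup (cball 0 1)) S = \<Gamma>)"

text \<open>No fixed point inside the disc and exactly one on the circle.\<close>

definition parabolic :: "(complex \<Rightarrow> complex) \<Rightarrow> bool" where
  "parabolic g \<longleftrightarrow> g \<in> disc_moebius \<and>
     (\<forall>z\<in>ball 0 1. g z \<noteq> z) \<and> (\<exists>!p. p \<in> sphere 0 1 \<and> g p = p)"

section \<open>Limit points and conical limit points\<close>

definition limit_point :: "(complex \<Rightarrow> complex) set \<Rightarrow> complex \<Rightarrow> bool" where
  "limit_point \<Gamma> p \<longleftrightarrow> p \<in> sphere 0 1 \<and>
     (\<exists>z\<in>ball 0 1. \<exists>\<gamma>. (\<forall>n::nat. \<gamma> n \<in> \<Gamma>) \<and> (\<lambda>n. \<gamma> n z) \<longlonglongrightarrow> p)"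

text \<open>The distance of the Poincare metric (curvature \<open>-1\<close>); meaningful on the open disc only.\<close>

definition hyperbolic_dist :: "complex \<Rightarrow> complex \<Rightarrow> real" where
  "hyperbolic_dist z w =
     arcosh (1 + 2 * (norm (z - w))\<^sup>2 / ((1 - (norm z)\<^sup>2) * (1 - (norm w)\<^sup>2)))"

definition geodesic_ray_to :: "(real \<Rightarrow> complex) \<Rightarrow> complex \<Rightarrow> bool" where
  "geodesic_ray_to r p \<longleftrightarrow>
     (\<forall>t\<ge>0. r t \<in> ball 0 1) \<and>
     (\<forall>s\<ge>0. \<forall>t\<ge>0. hyperbolic_dist (r s) (r t) = \<bar>s - t\<bar>) \<and>
     (r \<longlongrightarrow> p) at_top"

definition conical_limit_point :: "(complex \<Rightarrow> complex) set \<Rightarrow> complex \<Rightarrow> bool" where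
  "conical_limit_point \<Gamma> p \<longleftrightarrow> limit_point \<Gamma> p \<and>
     (\<exists>\<gamma>. (\<forall>n::nat. \<gamma> n \<in> \<Gamma>) \<and> (\<lambda>n. \<gamma> n 0) \<longlonglongrightarrow> p \<and>
        (\<exists>r C. geodesic_ray_to r p \<and> (\<forall>n. \<exists>t\<ge>0. hyperbolic_dist (\<gamma> n 0) (r t) \<le> C)))"

section \<open>Concentration\<close>

definition circle_nbhd :: "complex set \<Rightarrow> complex \<Rightarrow> bool" where
  "circle_nbhd V p \<longleftrightarrow> openin (top_of_set (sphere 0 1)) V \<and> p \<in> V"

definition can_be_concentrated ::
    "(complex \<Rightarrow> complex) set \<Rightarrow> complex set \<Rightarrow> complex \<Rightarrow> bool" where
  "can_be_concentrated \<Gamma> U p \<longleftrightarrow>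
     openin (top_of_set (sphere 0 1)) U \<and>
     (\<forall>V. circle_nbhd V p \<longrightarrow> (\<exists>\<gamma>\<in>\<Gamma>. p \<in> \<gamma> ` U \<and> \<gamma> ` U \<subseteq> V))"

definition weak_concentration_point :: "(complex \<Rightarrow> complex) set \<Rightarrow> complex \<Rightarrow> bool" where
  "weak_concentration_point \<Gamma> p \<longleftrightarrow>
     limit_point \<Gamma> p \<and> (\<exists>U. connected U \<and> can_be_concentrated \<Gamma> U p)"

text \<open>
  The closure below is taken in the plane; for \<open>U\<close> in the circle it is the closure in the circle.
\<close>

definition geodesic_separation_point :: "(complex \<Rightarrow> complex) set \<Rightarrow> complex \<Rightarrow> bool" where
  "geodesic_separation_point \<Gamma> p \<longleftrightarrow> limit_point \<Gamma> p \<and>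
     (\<exists>W. circle_nbhd W p \<and>
        (\<forall>U. circle_nbhd U p \<and> connected U \<and> U \<subseteq> W \<longrightarrow>
           can_be_concentrated \<Gamma> U p \<or> can_be_concentrated \<Gamma> (sphere 0 1 - closure U) p))"

end

theory Submission
  imports Defs
begin

text \<open>
  Take pairwise disjoint caps of the disc, cut off by circles orthogonal to the unit circle, which
  accumulate only at the point 1 and do so from both sides: caps with even index lie in the upper
  half-plane, caps with odd index in the lower one. The reflections in these circles generate a
  free product of copies of the group with two elements, and \<open>\<Gamma>\<close> is its subgroup of words of even
  length. Ping-pong on the caps (\<open>ping_pong\<close>) makes every nonempty reduced word move 0 into a cap, which
  gives discreteness; finitely many generators involve only finitely many letters. A reduced even
  word whose first and last letters differ maps the cap of its first letter into itself and its
  inverse does the same for the cap of its last letter, so Brouwer's theorem gives two fixed points;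
  every other nonempty even word is conjugate to a shorter one. Hence no element is parabolic.

  A sequence \<open>s\<close> of letters with \<open>s n \<noteq> s (n + 1)\<close> codes a point \<open>p\<close> of the circle, the point common to
  the nested images \<open>\<gamma>\<^sub>n (C\<^bsub>s n\<^esub>)\<close> with \<open>\<gamma>\<^sub>n = \<rho>\<^bsub>s 0\<^esub> \<dots> \<rho>\<^bsub>s (n - 1)\<^esub>\<close>, and \<open>p\<close> determines \<open>s\<close>. So
  uncountably many codes give uncountably many points. The point \<open>x\<^sub>n = \<gamma>\<^sub>n\<inverse> p\<close> lies in the cap
  \<open>C\<^bsub>s n\<^esub>\<close> and \<open>a\<^sub>n = \<gamma>\<^sub>n\<inverse> 0\<close> in the cap \<open>C\<^bsub>s (n - 1)\<^esub>\<close>. The identity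
  \<open>\<bar>h 0 - p\<bar> \<bar>h\<inverse> 0 - h\<inverse> p\<bar> = 1 - \<bar>h 0\<bar>\<^sup>2\<close> turns nontangential approach of \<open>h 0\<close> to \<open>p\<close>, which is what
  a conical limit point amounts to, into a lower bound for the distance of \<open>h\<inverse> 0\<close> and \<open>h\<inverse> p\<close>.

  If \<open>s n\<close> tends to infinity with the parity of \<open>n\<close>, then \<open>x\<^sub>n\<close> and \<open>a\<^sub>n\<close> both tend to 1. Reflections do
  not increase distances outside their caps, so the same holds along any sequence of group elements
  whose orbit points converge to \<open>p\<close>, and \<open>p\<close> is not conical
  (\<open>not_conical_if_code_diverges\<close>). Yet for even \<open>n\<close> the open upper half circle contains \<open>x\<^sub>n\<close> and
  misses the cap \<open>C\<^bsub>s (n - 1)\<^esub>\<close>, so \<open>\<gamma>\<^sub>n\<close> concentrates it at \<open>p\<close>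
  (\<open>weak_concentration_if_coded\<close>).

  If instead \<open>s\<close> is 0 at even places and runs through different letters at odd places, then \<open>x\<^sub>n\<close>
  stays in one cap for even \<open>n\<close> while \<open>a\<^sub>n\<close> tends to 1, so \<open>p\<close> is conical
  (\<open>conical_if_code_returns\<close>). The arcs \<open>U\<close> bounding \<open>\<gamma>\<^sub>m (C\<^bsub>s m\<^esub>)\<close> with \<open>m\<close> odd are arbitrarily small
  neighborhoods of \<open>p\<close>. Because the letter \<open>s m\<close> occurs only once in \<open>s\<close>, every translate of \<open>U\<close> or of
  the complementary arc that contains \<open>p\<close> is either one fixed set or contains the point -1, and so
  neither can be concentrated at \<open>p\<close> (\<open>not_geodesic_separation_if_once\<close>).
\<close>

section \<open>Reflections in circles orthogonal to the unit circle\<close>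

text \<open>For \<open>norm c > 1\<close> the inversion in the circle around \<open>c\<close> that is orthogonal to the unit circle;
  orthogonality forces the squared radius \<open>(norm c)\<^sup>2 - 1\<close>. Since division by zero gives zero, the
  formula fixes the center, which makes it an involution of the whole plane.\<close>

definition reflection :: "complex \<Rightarrow> complex \<Rightarrow> complex" where
  "reflection c z = c + of_real ((norm c)\<^sup>2 - 1) / cnj (z - c)"

definition cap :: "complex \<Rightarrow> complex set" where
  "cap c = {z \<in> cball 0 1. (norm (z - c))\<^sup>2 \<le> (norm c)\<^sup>2 - 1}"

definition open_cap :: "complex \<Rightarrow> complex set" where
  "open_cap c = {z \<in> cball 0 1. (norm (z - c))\<^sup>2 < (norm c)\<^sup>2 - 1}"

text \<open>In this form the caps are the sublevel sets of an expression affine in \<open>c\<close>, free of the radius.\<close>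

lemma cap_alt: "z \<in> cap c \<longleftrightarrow> norm z \<le> 1 \<and> 1 + (norm z)\<^sup>2 \<le> 2 * Re (z * cnj c)"
  unfolding cap_def cmod_power2 by (auto simp: power2_eq_square algebra_simps)

lemma open_cap_alt: "z \<in> open_cap c \<longleftrightarrow> norm z \<le> 1 \<and> 1 + (norm z)\<^sup>2 < 2 * Re (z * cnj c)"
  unfolding open_cap_def cmod_power2 by (auto simp: power2_eq_square algebra_simps)

lemma open_cap_subset_cap: "open_cap c \<subseteq> cap c"
  by (auto simp: cap_def open_cap_def)

lemma cap_subset_disc: "cap c \<subseteq> cball 0 1"
  by (auto simp: cap_def)

lemma reflection_reflection [simp]:
  assumes "1 < norm c"
  shows "reflection c (reflection c z) = z"
proof -
  have "(norm c)\<^sup>2 \<noteq> 1" using assms power2_eq_1_iff[of "norm c"] by auto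
  hence *: "complex_of_real ((norm c)\<^sup>2 - 1) \<noteq> 0"
    by (metis eq_iff_diff_eq_0 of_real_eq_0_iff)
  show ?thesis
  proof (cases "z = c")
    case False
    then have "cnj (of_real ((norm c)\<^sup>2 - 1) / cnj (z - c)) = of_real ((norm c)\<^sup>2 - 1) / (z - c)"
      by simp
    moreover have "A / (A / B) = B" if "A \<noteq> 0" for A B :: complex
      using that by simp
    ultimately show ?thesis
      unfolding reflection_def add_diff_cancel_left' using * by simp
  qed (simp add: reflection_def)
qed

lemma norm_reflection_minus_center:
  assumes "1 < norm c"
  shows "norm (reflection c z - c) = ((norm c)\<^sup>2 - 1) / norm (z - c)"
proof -
  have "norm (cnj (z - c)) = norm (z - c)" by (rule complex_mod_cnj)
  moreover have "1 \<le> (norm c)\<^sup>2" using assms by simp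
  ultimately show ?thesis
    unfolding reflection_def add_diff_cancel_left' norm_divide norm_of_real by simp
qed

lemma dist_reflection:
  assumes "1 < norm c" "z \<noteq> c" "w \<noteq> c"
  shows "norm (reflection c z - reflection c w) =
           ((norm c)\<^sup>2 - 1) * norm (z - w) / (norm (z - c) * norm (w - c))"
proof -
  have nz: "cnj (z - c) \<noteq> 0" "cnj (w - c) \<noteq> 0" using assms by auto
  have "reflection c z - reflection c w =
          of_real ((norm c)\<^sup>2 - 1) * (1 / cnj (z - c) - 1 / cnj (w - c))"
    unfolding reflection_def
    by (simp only: right_diff_distrib add_diff_cancel_left mult_1_right times_divide_eq_right)
  also have "1 / cnj (z - c) - 1 / cnj (w - c) = cnj (w - z) / (cnj (z - c) * cnj (w - c))"
    using nz by (simp add: field_simps)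
  finally have "norm (reflection c z - reflection c w) =
      \<bar>(norm c)\<^sup>2 - 1\<bar> * (norm (cnj (w - z)) / (norm (cnj (z - c)) * norm (cnj (w - c))))"
    by (simp only: norm_mult norm_divide norm_of_real)
  moreover have "1 \<le> (norm c)\<^sup>2" using assms by simp
  ultimately show ?thesis
    by (simp only: complex_mod_cnj norm_minus_commute[of w z] abs_of_nonneg) simp
qed

lemma one_minus_norm_reflection:
  assumes "z \<noteq> c"
  shows "1 - (norm (reflection c z))\<^sup>2 =
           ((norm c)\<^sup>2 - 1) / (norm (z - c))\<^sup>2 * (1 - (norm z)\<^sup>2)"
proof -
  define k where "k = (norm c)\<^sup>2 - 1"
  define N where "N = (norm (z - c))\<^sup>2"
  define x where "x = Re z - Re c"
  define y where "y = Im z - Im c"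
  have N: "N = x\<^sup>2 + y\<^sup>2" "N \<noteq> 0" using assms by (auto simp: N_def x_def y_def cmod_power2 complex_eq_iff)
  have k: "(Re c)\<^sup>2 + (Im c)\<^sup>2 = 1 + k" by (simp add: k_def cmod_power2)
  have "reflection c z = c + of_real k * (z - c) / of_real N"
  proof -
    have "(z - c) * cnj (z - c) = of_real N" unfolding N_def by (rule complex_norm_square[symmetric])
    moreover have "cnj (z - c) \<noteq> 0" "z - c \<noteq> 0" using assms by auto
    ultimately have "1 / cnj (z - c) = (z - c) / of_real N"
      by (metis divide_divide_eq_left divide_self)
    thus ?thesis unfolding reflection_def k_def by (metis times_divide_eq_right mult.right_neutral)
  qed
  hence "Re (reflection c z) = Re c + k * x / N" "Im (reflection c z) = Im c + k * y / N"
    by (auto simp: x_def y_def)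
  hence "(norm (reflection c z))\<^sup>2 = (Re c + k * x / N)\<^sup>2 + (Im c + k * y / N)\<^sup>2"
    by (simp add: cmod_power2)
  also have "\<dots> = ((Re c)\<^sup>2 + (Im c)\<^sup>2) + 2 * k * (Re c * x + Im c * y) / N + k\<^sup>2 * (x\<^sup>2 + y\<^sup>2) / N\<^sup>2"
    by (simp add: power2_eq_square algebra_simps add_divide_distrib)
  also have "\<dots> = 1 + k + 2 * k * (Re c * x + Im c * y) / N + k\<^sup>2 / N"
    using N k by (simp add: power2_eq_square)
  finally have "1 - (norm (reflection c z))\<^sup>2 = - (k / N * (N + 2 * (Re c * x + Im c * y) + k))"
    using N(2) by (simp add: field_simps power2_eq_square)
  moreover have "(norm z)\<^sup>2 = N + 2 * (Re c * x + Im c * y) + k + 1"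
  proof -
    have "(norm z)\<^sup>2 = (Re c + x)\<^sup>2 + (Im c + y)\<^sup>2" by (simp add: x_def y_def cmod_power2)
    thus ?thesis using k N(1) by (simp add: power2_eq_square algebra_simps)
  qed
  ultimately show ?thesis unfolding k_def[symmetric] N_def[symmetric]
    by (simp add: algebra_simps)
qed

lemma center_not_in_disc: "1 < norm c \<Longrightarrow> norm z \<le> 1 \<Longrightarrow> z \<noteq> c"
  by auto

lemma norm_reflection_le_1:
  assumes "1 < norm c" "norm z \<le> 1"
  shows "norm (reflection c z) \<le> 1"
proof -
  have "0 \<le> ((norm c)\<^sup>2 - 1) / (norm (z - c))\<^sup>2 * (1 - (norm z)\<^sup>2)"
    using assms by (intro mult_nonneg_nonneg divide_nonneg_nonneg) (auto simp: abs_square_le_1)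
  hence "(norm (reflection c z))\<^sup>2 \<le> 1"
    using one_minus_norm_reflection[OF center_not_in_disc[OF assms]] by simp
  thus ?thesis by (simp add: abs_square_le_1)
qed

lemma norm_reflection_less_1:
  assumes "1 < norm c" "norm z < 1"
  shows "norm (reflection c z) < 1"
proof -
  have z: "z \<noteq> c" using assms by auto
  have "0 < ((norm c)\<^sup>2 - 1) / (norm (z - c))\<^sup>2 * (1 - (norm z)\<^sup>2)"
    using assms z by (intro mult_pos_pos divide_pos_pos) (auto simp: abs_square_less_1)
  hence "(norm (reflection c z))\<^sup>2 < 1" using one_minus_norm_reflection[OF z] by simp
  thus ?thesis by (simp add: abs_square_less_1)
qed

lemma norm_reflection_eq_1:
  assumes "1 < norm c" "norm z = 1"
  shows "norm (reflection c z) = 1"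
proof -
  have "z \<noteq> c" using assms by auto
  hence "(norm (reflection c z))\<^sup>2 = 1" using one_minus_norm_reflection[of z c] assms by simp
  thus ?thesis using power2_eq_1_iff[of "norm (reflection c z)"] norm_ge_zero[of "reflection c z"] by linarith
qed

lemma continuous_on_reflection:
  assumes "1 < norm c"
  shows "continuous_on (cball 0 1) (reflection c)"
  unfolding reflection_def using assms by (intro continuous_intros) auto

text \<open>Outside the open cap both distances to the center are at least the radius, so the factor by
  which the inversion changes the distance of two points is at most 1.\<close>

lemma reflection_nonexpanding:
  assumes c: "1 < norm c" and "norm z \<le> 1" "norm w \<le> 1" "z \<notin> open_cap c" "w \<notin> open_cap c"
  shows "norm (reflection c z - reflection c w) \<le> norm (z - w)"
proof -
  define r2 where "r2 = (norm c)\<^sup>2 - 1"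
  have r2: "r2 > 0" unfolding r2_def using c by simp
  have zw: "z \<noteq> c" "w \<noteq> c" using center_not_in_disc[OF c] assms by auto
  have "r2 \<le> (norm (z - c))\<^sup>2" "r2 \<le> (norm (w - c))\<^sup>2"
    using assms by (auto simp: open_cap_def r2_def)
  hence "r2 * r2 \<le> (norm (z - c))\<^sup>2 * (norm (w - c))\<^sup>2" using r2 by (intro mult_mono) auto
  hence "r2\<^sup>2 \<le> (norm (z - c) * norm (w - c))\<^sup>2" by (simp add: power2_eq_square mult_ac)
  hence "r2 \<le> norm (z - c) * norm (w - c)" by (rule power2_le_imp_le) simp
  hence "r2 * norm (z - w) \<le> norm (z - c) * norm (w - c) * norm (z - w)"
    by (rule mult_right_mono) simp
  moreover have "0 < norm (z - c) * norm (w - c)" using zw by simp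
  ultimately show ?thesis
    using dist_reflection[OF c zw] by (simp add: r2_def[symmetric] pos_divide_le_eq mult.commute)
qed

lemma norm_reflection_minus_center_power2:
  assumes c: "1 < norm c" and "norm z \<le> 1"
  shows "(norm (reflection c z - c))\<^sup>2 * (norm (z - c))\<^sup>2 = ((norm c)\<^sup>2 - 1)\<^sup>2"
  using norm_reflection_minus_center[OF c, of z] center_not_in_disc[OF assms] by (simp add: power_divide)

lemma reflection_into_cap:
  assumes c: "1 < norm c" and "norm z \<le> 1" "z \<notin> open_cap c"
  shows "reflection c z \<in> cap c"
proof -
  define r2 where "r2 = (norm c)\<^sup>2 - 1"
  have r2: "r2 > 0" unfolding r2_def using c by simp
  have "r2 \<le> (norm (z - c))\<^sup>2" using assms by (auto simp: open_cap_def r2_def)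
  hence "(norm (reflection c z - c))\<^sup>2 * r2 \<le> r2 * r2"
    using norm_reflection_minus_center_power2[OF assms(1,2)]
    by (metis mult_left_mono power2_eq_square r2_def zero_le_power2)
  thus ?thesis using r2 norm_reflection_le_1[OF assms(1,2)] by (simp add: cap_def r2_def)
qed

lemma reflection_into_open_cap:
  assumes c: "1 < norm c" and "norm z \<le> 1" "z \<notin> cap c"
  shows "reflection c z \<in> open_cap c"
proof -
  define r2 where "r2 = (norm c)\<^sup>2 - 1"
  have r2: "r2 > 0" unfolding r2_def using c by simp
  have *: "r2 < (norm (z - c))\<^sup>2" using assms by (auto simp: cap_def r2_def)
  have "reflection c z \<noteq> c"
    using center_not_in_disc[OF c] norm_reflection_le_1[OF assms(1,2)] by auto
  hence "0 < (norm (reflection c z - c))\<^sup>2" by simp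
  hence "(norm (reflection c z - c))\<^sup>2 * r2 < r2 * r2"
    using norm_reflection_minus_center_power2[OF assms(1,2)] *
    by (metis mult_strict_left_mono power2_eq_square r2_def)
  thus ?thesis using r2 norm_reflection_le_1[OF assms(1,2)] by (simp add: open_cap_def r2_def)
qed

lemma reflection_of_open_cap:
  assumes "1 < norm c" "z \<in> open_cap c"
  shows "reflection c z \<notin> cap c"
proof
  assume *: "reflection c z \<in> cap c"
  have "norm z \<le> 1" using assms by (auto simp: open_cap_def)
  moreover have "(norm (reflection c z - c))\<^sup>2 * (norm (z - c))\<^sup>2 < ((norm c)\<^sup>2 - 1) * ((norm c)\<^sup>2 - 1)"
    using * assms by (intro mult_le_less_imp_less) (auto simp: cap_def open_cap_def dest: center_not_in_disc[OF assms(1)]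
       intro: norm_reflection_le_1)
  ultimately show False
    using norm_reflection_minus_center_power2[OF assms(1), of z] by (simp add: power2_eq_square)
qed

lemma dist_in_cap:
  assumes "z \<in> cap c" "w \<in> cap c"
  shows "dist z w \<le> 2 * sqrt ((norm c)\<^sup>2 - 1)"
proof -
  have "norm (z - c) \<le> sqrt ((norm c)\<^sup>2 - 1)" "norm (w - c) \<le> sqrt ((norm c)\<^sup>2 - 1)"
    using assms by (auto simp: cap_def intro: real_le_rsqrt)
  thus ?thesis using norm_triangle_ineq4[of "z - c" "w - c"] by (simp add: dist_norm)
qed

lemma convex_compact_cap: "convex (cap c)" "compact (cap c)"
proof -
  have *: "cap c = cball 0 1 \<inter> cball c (sqrt ((norm c)\<^sup>2 - 1))" if "1 \<le> norm c"
  proof -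
    have iff: "(norm (z - c))\<^sup>2 \<le> (norm c)\<^sup>2 - 1 \<longleftrightarrow> norm (z - c) \<le> sqrt ((norm c)\<^sup>2 - 1)" for z
      using real_sqrt_le_iff[of "(norm (z - c))\<^sup>2" "(norm c)\<^sup>2 - 1"]
      by (simp only: real_sqrt_abs abs_norm_cancel)
    show ?thesis unfolding cap_def iff by (auto simp: dist_norm norm_minus_commute)
  qed
  have e: "cap c = {}" if "norm c < 1"
  proof -
    have "(norm c)\<^sup>2 < 1" using that by (simp add: abs_square_less_1)
    thus ?thesis by (auto simp: cap_def) (smt (verit) zero_le_power2)
  qed
  show "convex (cap c)" using * e by (cases "norm c < 1") (auto intro: convex_Int)
  show "compact (cap c)" using * e by (cases "norm c < 1") (auto intro: compact_Int)
qed

lemma cap_meets_sphere: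
  assumes "1 < norm c"
  shows "cap c \<inter> sphere 0 1 \<noteq> {}"
proof -
  have "sgn c \<in> cap c"
  proof -
    have "sgn c * cnj c = of_real (norm c)"
      using assms by (auto simp: sgn_eq complex_norm_square[symmetric] power2_eq_square)
    thus ?thesis using assms by (auto simp: cap_alt norm_sgn)
  qed
  moreover have "norm (sgn c) = 1" using assms by (auto simp: norm_sgn)
  ultimately show ?thesis by auto
qed

lemma zero_notin_cap: "0 \<notin> cap c"
  by (simp add: cap_alt)

lemma norm_ge_in_cap:
  assumes "z \<in> cap c"
  shows "1 \<le> 2 * norm z * norm c"
proof -
  have "1 + (norm z)\<^sup>2 \<le> 2 * Re (z * cnj c)" using assms by (simp add: cap_alt)
  also have "Re (z * cnj c) \<le> norm (z * cnj c)" by (rule complex_Re_le_cmod)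
  finally have "1 + (norm z)\<^sup>2 \<le> 2 * (norm z * norm c)" by (simp add: norm_mult)
  thus ?thesis using zero_le_power2[of "norm z"] unfolding mult.assoc by linarith
qed

text \<open>In the orthonormal frame \<open>u\<close>, \<open>\<i> u\<close> the set is the graph of \<open>\<lambda>y. sqrt (1 - y\<^sup>2)\<close> over an interval;
  \<open>h \<ge> 0\<close> keeps it on that half of the circle.\<close>

lemma connected_circle_halfplane:
  assumes u: "norm u = 1" and h: "0 \<le> h"
  shows "connected {z \<in> sphere 0 1. h < Re (z * cnj u)}"
proof -
  have uu: "u * cnj u = 1" using u by (simp add: complex_norm_square[symmetric])
  have eq: "{z \<in> sphere 0 1. h < Re (z * cnj u)} = (\<lambda>y. u * Complex (sqrt (1 - y\<^sup>2)) y) ` {y. \<bar>y\<bar> < 1 \<and> h\<^sup>2 < 1 - y\<^sup>2}"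
    (is "?A = ?f ` ?B")
  proof safe
    fix z assume z: "z \<in> sphere 0 1" "h < Re (z * cnj u)"
    define y where "y = Im (z * cnj u)"
    have "norm (z * cnj u) = 1" using z u by (simp add: norm_mult)
    hence n: "(Re (z * cnj u))\<^sup>2 + y\<^sup>2 = 1" unfolding y_def cmod_power2[symmetric] by simp
    have "h\<^sup>2 < (Re (z * cnj u))\<^sup>2" using z h by (intro power_strict_mono) auto
    hence y: "h\<^sup>2 < 1 - y\<^sup>2" using n by simp
    hence "y\<^sup>2 < 1" using zero_le_power2[of h] by linarith
    hence y1: "\<bar>y\<bar> < 1" by (simp add: abs_square_less_1)
    have "sqrt (1 - y\<^sup>2) = Re (z * cnj u)"
      using n z h by (intro real_sqrt_unique) auto
    hence "Complex (sqrt (1 - y\<^sup>2)) y = z * cnj u" by (simp add: complex_eq_iff y_def)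
    hence "z = ?f y" using uu by (metis mult.commute mult.left_commute mult.right_neutral)
    thus "z \<in> ?f ` ?B" using y y1 by blast
  next
    fix y assume y: "\<bar>y\<bar> < 1" "h\<^sup>2 < 1 - y\<^sup>2"
    have y2: "y\<^sup>2 < 1" using y by (simp add: abs_square_less_1)
    show "?f y \<in> sphere 0 1" using u y2 by (simp add: norm_mult complex_norm)
    have "?f y * cnj u = Complex (sqrt (1 - y\<^sup>2)) y" using uu by (metis mult.commute mult.left_commute mult.right_neutral)
    thus "h < Re (?f y * cnj u)" using real_less_rsqrt[OF y(2)] by (simp only: complex.sel)
  qed
  have "?B = ball 0 (sqrt (1 - h\<^sup>2))"
  proof -
    have "h\<^sup>2 < 1 - y\<^sup>2 \<longleftrightarrow> \<bar>y\<bar> < sqrt (1 - h\<^sup>2)" for y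
      unfolding real_sqrt_abs[symmetric] real_sqrt_less_iff by auto
    moreover have "\<bar>y\<bar> < 1" if "\<bar>y\<bar> < sqrt (1 - h\<^sup>2)" for y
      by (rule less_le_trans[OF that]) simp
    ultimately show ?thesis by (auto simp: mem_ball)
  qed
  hence "connected ?B" by (metis connected_ball)
  moreover have "continuous_on ?B ?f"
    unfolding Complex_eq by (intro continuous_intros)
  ultimately show ?thesis unfolding eq by (rule connected_continuous_image[rotated])
qed

lemma connected_open_arc:
  assumes "1 < norm c"
  shows "connected (open_cap c \<inter> sphere 0 1)"
proof -
  have "open_cap c \<inter> sphere 0 1 = {z \<in> sphere 0 1. 1 / norm c < Re (z * cnj (sgn c))}"
  proof -
    have "z * cnj (sgn c) = z * cnj c / of_real (norm c)" for z
      by (simp add: sgn_eq)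
    hence iff: "1 / norm c < Re (z * cnj (sgn c)) \<longleftrightarrow> 1 < Re (z * cnj c)" for z
      using assms less_divide_eq_1_pos[of "norm c"] by (simp only: Re_divide_of_real) (auto simp: divide_less_cancel)
    show ?thesis unfolding iff by (auto simp: open_cap_alt)
  qed
  moreover have "norm (sgn c) = 1" using assms by (simp only: norm_sgn) auto
  ultimately show ?thesis using connected_circle_halfplane[of "sgn c" "1 / norm c"] by (metis divide_nonneg_nonneg norm_ge_zero zero_le_one)
qed

section \<open>Reflection words on a system of disjoint caps\<close>

text \<open>The parity conditions place the caps on the two sides of their accumulation point 1. They also keep
  all caps away from the real points -1 and 1, which serve as base points on the circle outside
  every cap.\<close>

locale cap_system =
  fixes c :: "nat \<Rightarrow> complex"
  assumes norm_center: "1 < norm (c i)"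
    and caps_disjoint: "i \<noteq> j \<Longrightarrow> cap (c i) \<inter> cap (c j) = {}"
    and centers_to_1: "c \<longlonglongrightarrow> 1"
    and even_cap_upper: "even i \<Longrightarrow> z \<in> cap (c i) \<Longrightarrow> 0 < Im z"
    and odd_cap_lower: "odd i \<Longrightarrow> z \<in> cap (c i) \<Longrightarrow> Im z < 0"
begin

lemma same_cap: "z \<in> cap (c i) \<Longrightarrow> z \<in> cap (c j) \<Longrightarrow> i = j"
  using caps_disjoint by blast

lemma notin_other_cap: "z \<in> cap (c i) \<Longrightarrow> i \<noteq> j \<Longrightarrow> z \<notin> cap (c j)"
  using caps_disjoint by blast

lemma notin_open_capI: "z \<notin> cap (c i) \<Longrightarrow> z \<notin> open_cap (c i)"
  using open_cap_subset_cap by blast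

lemma real_notin_cap: "Im z = 0 \<Longrightarrow> z \<notin> cap (c i)"
  using even_cap_upper[of i z] odd_cap_lower[of i z] by auto

lemma norm_le_1_if_cap: "z \<in> cap (c i) \<Longrightarrow> norm z \<le> 1"
  by (simp add: cap_def)

primrec act :: "nat list \<Rightarrow> complex \<Rightarrow> complex" where
  "act [] z = z"
| "act (i # w) z = reflection (c i) (act w z)"

lemma act_append [simp]: "act (v @ w) z = act v (act w z)"
  by (induction v) auto

lemma act_rev_act [simp]: "act (rev w) (act w z) = z"
  by (induction w arbitrary: z) (auto simp: norm_center)

lemma act_act_rev [simp]: "act w (act (rev w) z) = z"
  using act_rev_act[of "rev w"] by simp

lemma norm_act_le_1: "norm z \<le> 1 \<Longrightarrow> norm (act w z) \<le> 1"
  by (induction w) (auto intro: norm_reflection_le_1 norm_center)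

lemma norm_act_eq_1: "norm z = 1 \<Longrightarrow> norm (act w z) = 1"
  by (induction w) (auto intro: norm_reflection_eq_1 norm_center)

lemma continuous_on_act: "continuous_on (cball 0 1) (act w)"
proof (induction w)
  case (Cons i w)
  have "continuous_on (act w ` cball 0 1) (reflection (c i))"
    by (rule continuous_on_subset[OF continuous_on_reflection[OF norm_center]])
       (auto intro: norm_act_le_1)
  thus ?case using continuous_on_compose[OF Cons.IH] by (simp add: o_def)
qed simp

text \<open>Cancelling two equal neighbors keeps the map and the parity of the length, so evenness survives the
  passage to reduced words.\<close>

lemma exists_reduced_word:
  "\<exists>v. distinct_adj v \<and> set v \<subseteq> set w \<and> even (length v) = even (length w) \<and> act v = act w"
proof (induction w)
  case (Cons i w)
  then obtain v where v: "distinct_adj v" "set v \<subseteq> set w" "even (length v) = even (length w)"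
    "act v = act w" by blast
  show ?case
  proof (cases "v \<noteq> [] \<and> hd v = i")
    case True
    then obtain u where u: "v = i # u" by (cases v) auto
    have "act u = act (i # w)"
    proof
      have "reflection (c i) (act u z) = act w z" for z using v(4) by (auto simp: u fun_eq_iff)
      thus "act u z = act (i # w) z" for z by (metis act.simps(2) reflection_reflection norm_center)
    qed
    thus ?thesis using v u by (intro exI[of _ u]) (auto dest: distinct_adj_ConsD)
  next
    case False
    thus ?thesis using v by (intro exI[of _ "i # v"]) (auto simp: distinct_adj_Cons fun_eq_iff)
  qed
qed (auto intro: exI[of _ "[]"])

text \<open>Each letter reflects the outside of its cap into that cap, and the cap lies outside the cap of the
  next letter because the two letters differ.\<close>

lemma ping_pong:
  assumes "distinct_adj w" "w \<noteq> []" "norm z \<le> 1" "z \<notin> open_cap (c (last w))"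
  shows "act w z \<in> cap (c (hd w))"
  using assms
proof (induction w)
  case (Cons i w)
  have "act w z \<notin> open_cap (c i)"
  proof (cases "w = []")
    case False
    hence "act w z \<in> cap (c (hd w))" "hd w \<noteq> i" using Cons by (auto simp: distinct_adj_Cons)
    thus ?thesis by (intro notin_open_capI notin_other_cap)
  qed (use Cons.prems in auto)
  thus ?case using Cons.prems by (auto intro: reflection_into_cap norm_center norm_act_le_1)
qed simp

lemma ping_pong_open:
  assumes "distinct_adj w" "w \<noteq> []" "norm z \<le> 1" "z \<notin> cap (c (last w))"
  shows "act w z \<in> open_cap (c (hd w))"
  using assms
proof (induction w)
  case (Cons i w)
  have "act w z \<notin> cap (c i)"
  proof (cases "w = []")
    case False
    hence "act w z \<in> cap (c (hd w))" "hd w \<noteq> i"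
      using Cons open_cap_subset_cap by (auto simp: distinct_adj_Cons)
    thus ?thesis by (intro notin_other_cap)
  qed (use Cons.prems in auto)
  thus ?case using Cons.prems by (auto intro: reflection_into_open_cap norm_center norm_act_le_1)
qed simp

text \<open>By ping-pong every reflection in the word acts on points outside its own open cap, where it does not
  increase distances.\<close>

lemma act_nonexpanding:
  assumes "distinct_adj w" "norm z \<le> 1" "norm z' \<le> 1"
    and "w \<noteq> [] \<Longrightarrow> z \<notin> open_cap (c (last w))" "w \<noteq> [] \<Longrightarrow> z' \<notin> open_cap (c (last w))"
  shows "dist (act w z) (act w z') \<le> dist z z'"
  using assms
proof (induction w)
  case (Cons i w)
  have *: "act w x \<notin> open_cap (c i)" if "norm x \<le> 1" "x \<notin> open_cap (c (last (i # w)))" for x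
  proof (cases "w = []")
    case False
    hence "act w x \<in> cap (c (hd w))" "hd w \<noteq> i"
      using ping_pong[of w x] Cons.prems that by (auto simp: distinct_adj_Cons)
    thus ?thesis by (intro notin_open_capI notin_other_cap)
  qed (use that in auto)
  have "dist (act (i # w) z) (act (i # w) z') \<le> dist (act w z) (act w z')"
    using reflection_nonexpanding[OF norm_center, of "act w z" "act w z'" i] *[of z] *[of z'] Cons.prems
    by (simp add: dist_norm norm_act_le_1)
  also have "\<dots> \<le> dist z z'"
    using Cons.prems by (intro Cons.IH) (auto simp: distinct_adj_Cons)
  finally show ?case .
qed simp

text \<open>The letters of \<open>s\<close> are stripped off \<open>z\<close> one at a time, as in a continued fraction expansion.\<close>

primrec orbit :: "(nat \<Rightarrow> nat) \<Rightarrow> complex \<Rightarrow> nat \<Rightarrow> complex" where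
  "orbit s z 0 = z"
| "orbit s z (Suc n) = reflection (c (s n)) (orbit s z n)"

definition codes :: "(nat \<Rightarrow> nat) \<Rightarrow> complex \<Rightarrow> bool" where
  "codes s p \<longleftrightarrow> norm p = 1 \<and> (\<forall>n. orbit s p n \<in> cap (c (s n)))"

definition prefix :: "(nat \<Rightarrow> nat) \<Rightarrow> nat \<Rightarrow> nat list" where
  "prefix s n = map s [0..<n]"

lemma length_prefix [simp]: "length (prefix s n) = n"
  by (simp add: prefix_def)

lemma prefix_0 [simp]: "prefix s 0 = []"
  by (simp add: prefix_def)

lemma prefix_Suc: "prefix s (Suc n) = prefix s n @ [s n]"
  by (simp add: prefix_def)

lemma nth_prefix: "k < n \<Longrightarrow> prefix s n ! k = s k"
  by (simp add: prefix_def)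

lemma last_prefix: "0 < n \<Longrightarrow> last (prefix s n) = s (n - 1)"
  by (cases n) (auto simp: prefix_Suc)

lemma orbit_eq_act: "orbit s z n = act (rev (prefix s n)) z"
  by (induction n) (auto simp: prefix_Suc)

lemma act_prefix_orbit [simp]: "act (prefix s n) (orbit s z n) = z"
  by (simp add: orbit_eq_act)

lemma orbit_act_prefix [simp]: "orbit s (act (prefix s n) z) n = z"
  by (simp add: orbit_eq_act)

lemma norm_orbit_le_1: "norm z \<le> 1 \<Longrightarrow> norm (orbit s z n) \<le> 1"
  by (simp add: orbit_eq_act norm_act_le_1)

lemma orbit_shift:
  "orbit s z (Suc n) = orbit (\<lambda>k. s (Suc k)) (reflection (c (s 0)) z) n"
  by (induction n) auto

lemma distinct_adj_map_upt:
  assumes "\<And>n. s n \<noteq> s (Suc n)"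
  shows "distinct_adj (map s [k..<n])"
  using assms by (auto simp: distinct_adj_conv_nth)

lemma distinct_adj_prefix: "(\<And>n. s n \<noteq> s (Suc n)) \<Longrightarrow> distinct_adj (prefix s n)"
  unfolding prefix_def by (rule distinct_adj_map_upt)

text \<open>Ping-pong locates \<open>act w y\<close> in the cap of the first letter of \<open>w\<close>. As this cap is also the one of
  \<open>s 0\<close>, the letters agree; strip them off and repeat with the shifted sequence.\<close>

lemma reduced_word_follows_code:
  assumes "distinct_adj w" "norm y \<le> 1" "w \<noteq> [] \<Longrightarrow> y \<notin> open_cap (c (last w))"
    and "k < length w" "\<And>l. l \<le> k \<Longrightarrow> orbit s (act w y) l \<in> cap (c (s l))"
  shows "w ! k = s k"
  using assms
proof (induction w arbitrary: s k)
  case (Cons i w)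
  have "act (i # w) y \<in> cap (c i)" using ping_pong[of "i # w" y] Cons.prems by simp
  moreover have "act (i # w) y \<in> cap (c (s 0))" using Cons.prems(5)[of 0] by simp
  ultimately have i: "i = s 0" by (rule same_cap)
  show ?case
  proof (cases k)
    case (Suc k')
    have "w ! k' = s (Suc k')"
    proof (rule Cons.IH)
      show "orbit (\<lambda>k. s (Suc k)) (act w y) l \<in> cap (c (s (Suc l)))" if "l \<le> k'" for l
        using Cons.prems(5)[of "Suc l"] that norm_center
        by (simp only: orbit_shift Suc) (simp add: i)
    qed (use Cons.prems Suc in \<open>auto simp: distinct_adj_Cons\<close>)
    thus ?thesis by (simp add: Suc)
  qed (simp add: i)
qed simp

lemma eq_prefixI: "(\<And>k. k < length w \<Longrightarrow> w ! k = s k) \<Longrightarrow> w = prefix s (length w)"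
  by (intro nth_equalityI) (auto simp: nth_prefix)

lemma orbit_act_prefix_in_cap:
  assumes s: "\<And>n. s n \<noteq> s (Suc n)" and "k < n" "norm y \<le> 1" "y \<notin> open_cap (c (s (n - 1)))"
  shows "orbit s (act (prefix s n) y) k \<in> cap (c (s k))"
proof -
  have "prefix s n = prefix s k @ map s [k..<n]"
    unfolding prefix_def map_append[symmetric] using assms(2) by (metis less_imp_le upt_add_eq_append le0 le_add_diff_inverse)
  hence "orbit s (act (prefix s n) y) k = act (map s [k..<n]) y"
    by (simp add: orbit_eq_act)
  moreover have "hd (map s [k..<n]) = s k" "last (map s [k..<n]) = s (n - 1)"
    using assms(2) by (auto simp: hd_map last_map)
  ultimately show ?thesis
    using ping_pong[OF distinct_adj_map_upt[of s k n, OF s], of y] assms by simp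
qed

text \<open>The points of the circle whose \<open>n\<close>-th orbit point lies in the prescribed cap form a decreasing
  sequence of nonempty compact sets.\<close>

lemma code_exists:
  assumes s: "\<And>n. s n \<noteq> s (Suc n)"
  shows "\<exists>p. codes s p"
proof -
  define F where "F = (\<lambda>n. {p \<in> sphere 0 1. orbit s p n \<in> cap (c (s n))})"
  have "closed (F n)" for n
  proof -
    have "continuous_on (sphere 0 1) (\<lambda>p. orbit s p n)"
      unfolding orbit_eq_act by (rule continuous_on_subset[OF continuous_on_act]) auto
    hence "closed (sphere 0 1 \<inter> (\<lambda>p. orbit s p n) -` cap (c (s n)))"
      by (intro continuous_closed_preimage compact_imp_closed convex_compact_cap) auto
    thus ?thesis by (simp add: F_def vimage_def Int_def)
  qed
  moreover have "F n \<noteq> {}" for n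
  proof -
    obtain x where "x \<in> cap (c (s n))" "norm x = 1"
      using cap_meets_sphere[OF norm_center, of "s n"] by auto
    hence "act (prefix s n) x \<in> F n" by (simp add: F_def norm_act_eq_1)
    thus ?thesis by blast
  qed
  moreover have "F (Suc n) \<subseteq> F n" for n
  proof
    fix p assume p: "p \<in> F (Suc n)"
    hence "orbit s p (Suc n) \<in> cap (c (s (Suc n)))" by (simp add: F_def)
    hence "orbit s p (Suc n) \<notin> open_cap (c (s n))"
      using s[of n] by (metis notin_open_capI notin_other_cap)
    hence "reflection (c (s n)) (orbit s p (Suc n)) \<in> cap (c (s n))"
      using p by (intro reflection_into_cap norm_center norm_orbit_le_1) (auto simp: F_def)
    thus "p \<in> F n" using p by (simp add: F_def norm_center)
  qed
  hence "m \<le> n \<Longrightarrow> F n \<subseteq> F m" for m n by (rule lift_Suc_antimono_le)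
  moreover have "bounded (F 0)" by (rule bounded_subset[of "sphere 0 1"]) (auto simp: F_def)
  ultimately obtain p where "\<And>n. p \<in> F n" by (rule bounded_closed_nest[of F]) blast+
  thus ?thesis by (auto simp: F_def codes_def)
qed

lemma code_unique:
  assumes "codes s p" "codes s' p"
  shows "s = s'"
proof
  have orb: "orbit s p n = orbit s' p n" for n
  proof (induction n)
    case (Suc n)
    have "s n = s' n" using assms Suc by (auto simp: codes_def intro: same_cap dest!: spec[of _ n])
    thus ?case using Suc by simp
  qed simp
  show "s n = s' n" for n
    using assms orb[of n] by (auto simp: codes_def intro: same_cap dest!: spec[of _ n])
qed

text \<open>The next orbit point lies in a different cap, hence outside the closed cap that it is reflected into.\<close>

lemma orbit_in_open_cap:
  assumes "codes s p" "\<And>n. s n \<noteq> s (Suc n)"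
  shows "orbit s p n \<in> open_cap (c (s n))"
proof -
  have "orbit s p (Suc n) \<notin> cap (c (s n))"
    using assms by (metis codes_def notin_other_cap)
  hence "reflection (c (s n)) (orbit s p (Suc n)) \<in> open_cap (c (s n))"
    using assms by (intro reflection_into_open_cap norm_center norm_orbit_le_1) (auto simp: codes_def)
  thus ?thesis by (simp add: norm_center)
qed

lemma radii_to_0: "(\<lambda>i. sqrt ((norm (c i))\<^sup>2 - 1)) \<longlonglongrightarrow> 0"
proof -
  have "(\<lambda>i. sqrt ((norm (c i))\<^sup>2 - 1)) \<longlonglongrightarrow> sqrt ((norm (1::complex))\<^sup>2 - 1)"
    by (intro tendsto_intros centers_to_1)
  thus ?thesis by simp
qed

text \<open>The prefix of length \<open>k\<close> ends in a letter other than \<open>s k\<close>, so it does not increase distances on the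
  cap of \<open>s k\<close>: cylinders are no larger than the last cap used.\<close>

lemma dist_cylinder:
  assumes s: "\<And>n. s n \<noteq> s (Suc n)" and "norm z \<le> 1" "norm z' \<le> 1"
    and in_cap: "orbit s z k \<in> cap (c (s k))" "orbit s z' k \<in> cap (c (s k))"
  shows "dist z z' \<le> 2 * sqrt ((norm (c (s k)))\<^sup>2 - 1)"
proof -
  have *: "x \<notin> open_cap (c (last (prefix s k)))" if "prefix s k \<noteq> []" "x \<in> cap (c (s k))" for x
  proof -
    have "0 < k" using that by (cases k) auto
    hence "s k \<noteq> last (prefix s k)" using s[of "k - 1"] by (simp add: last_prefix)
    thus ?thesis using that by (intro notin_open_capI notin_other_cap)
  qed
  have "dist (act (prefix s k) (orbit s z k)) (act (prefix s k) (orbit s z' k)) \<le>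
          dist (orbit s z k) (orbit s z' k)"
    by (intro act_nonexpanding distinct_adj_prefix s norm_orbit_le_1 assms * in_cap)
  also have "\<dots> \<le> 2 * sqrt ((norm (c (s k)))\<^sup>2 - 1)" by (rule dist_in_cap[OF in_cap])
  finally show ?thesis by simp
qed

text \<open>Cylinders are nested and some letters are large, that is, belong to small caps; this makes the
  cylinders around \<open>p\<close> shrink even if small letters recur.\<close>

lemma act_prefix_near:
  assumes s: "\<And>n. s n \<noteq> s (Suc n)" and p: "codes s p" and unb: "\<And>N. \<exists>k. N \<le> s k" and "0 < e"
  shows "\<exists>K. \<forall>n>K. \<forall>y. norm y \<le> 1 \<longrightarrow> y \<notin> open_cap (c (s (n - 1))) \<longrightarrow> dist (act (prefix s n) y) p < e"
proof -
  have "eventually (\<lambda>i. sqrt ((norm (c i))\<^sup>2 - 1) < e / 2) sequentially"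
    using \<open>0 < e\<close> by (intro order_tendstoD(2)[OF radii_to_0]) auto
  then obtain N where N: "\<And>i. N \<le> i \<Longrightarrow> sqrt ((norm (c i))\<^sup>2 - 1) < e / 2"
    by (auto simp: eventually_sequentially)
  obtain K where K: "N \<le> s K" using unb by blast
  have "dist (act (prefix s n) y) p < e"
    if "K < n" "norm y \<le> 1" "y \<notin> open_cap (c (s (n - 1)))" for n y
  proof -
    have "dist (act (prefix s n) y) p \<le> 2 * sqrt ((norm (c (s K)))\<^sup>2 - 1)"
      using that p by (intro dist_cylinder orbit_act_prefix_in_cap s norm_act_le_1) (auto simp: codes_def)
    thus ?thesis using N[OF K] by simp
  qed
  thus ?thesis by blast
qed

end

section \<open>The Fuchsian group of even words\<close>

text \<open>The zero of the map is \<open>- b / a\<close> and its rotation factor is \<open>a / cnj a\<close>.\<close>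

lemma moebius_function_of_matrix:
  assumes "norm b < norm a"
  shows "\<exists>t w. norm w < 1 \<and> (\<forall>z. Moebius_function t w z = (a * z + b) / (cnj b * z + cnj a))"
proof -
  have a: "a \<noteq> 0" using assms by auto
  hence "norm (a / cnj a) = 1" by (simp add: norm_divide)
  then obtain t where t: "a / cnj a = exp (\<i> * of_real t)" using complex_norm_eq_1_exp by metis
  have "Moebius_function t (- b / a) z = (a * z + b) / (cnj b * z + cnj a)" for z
  proof -
    have "Moebius_function t (- b / a) z = a / cnj a * ((a * z + b) / a) / ((cnj a + cnj b * z) / cnj a)"
      unfolding Moebius_function_def t[symmetric] using a by (simp add: add_divide_distrib)
    also have "\<dots> = (a * z + b) / (cnj b * z + cnj a)" using a by (simp add: add.commute)
    finally show ?thesis .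
  qed
  moreover have "norm (- b / a) < 1" using assms a by (simp add: norm_divide pos_divide_less_eq)
  ultimately show ?thesis by blast
qed

text \<open>The factor \<open>\<i>\<close> brings the composition back to the shape with conjugate entries in the denominator,
  now applied to \<open>cnj u\<close>. So every letter toggles a complex conjugation of the argument.\<close>

lemma reflection_of_matrix:
  assumes c: "1 < norm c" and ab: "norm b < norm a" and u: "norm u \<le> 1"
    and z: "norm ((a * u + b) / (cnj b * u + cnj a)) \<le> 1"
  shows "reflection c ((a * u + b) / (cnj b * u + cnj a)) =
           (\<i> * (c * cnj a - b) * cnj u + \<i> * (c * cnj b - a)) /
           (cnj (\<i> * (c * cnj b - a)) * cnj u + cnj (\<i> * (c * cnj a - b)))"
proof -
  define v where "v = cnj u"
  define D where "D = b * v + a"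
  define N where "N = cnj a * v + cnj b"
  have "norm (b * v) \<le> norm b" using u by (simp add: norm_mult v_def mult_left_le)
  hence D: "D \<noteq> 0" unfolding D_def using ab by (metis add_eq_0_iff norm_minus_cancel not_le)
  define z where "z = (a * u + b) / (cnj b * u + cnj a)"
  have cz: "cnj z = N / D" by (simp add: z_def N_def D_def v_def)
  have "z \<noteq> c" using center_not_in_disc[OF c] assms(4) by (auto simp: z_def)
  hence nz: "N / D - cnj c \<noteq> 0" using cz by (metis complex_cnj_cancel_iff right_minus_eq)
  hence nz': "N - cnj c * D \<noteq> 0" using D by (simp add: field_simps)
  have "reflection c z = c + (c * cnj c - 1) / (N / D - cnj c)"
    by (simp add: reflection_def cz complex_norm_square[symmetric])
  also have "\<dots> = (c * N - D) / (N - cnj c * D)"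
    using nz nz' D by (simp add: field_simps)
  also have "\<dots> = (\<i> * (c * N - D)) / (\<i> * (N - cnj c * D))" by simp
  also have "\<dots> = (\<i> * (c * cnj a - b) * v + \<i> * (c * cnj b - a)) /
           (cnj (\<i> * (c * cnj b - a)) * v + cnj (\<i> * (c * cnj a - b)))"
    by (simp add: N_def D_def algebra_simps)
  finally show ?thesis by (simp add: z_def v_def)
qed

lemma reflected_matrix_norm:
  assumes c: "1 < norm c" and ab: "norm b < norm a"
  shows "norm (\<i> * (c * cnj b - a)) < norm (\<i> * (c * cnj a - b))"
proof -
  have "(norm (c * cnj a - b))\<^sup>2 - (norm (c * cnj b - a))\<^sup>2 =
          ((norm c)\<^sup>2 - 1) * ((norm a)\<^sup>2 - (norm b)\<^sup>2)"
    unfolding cmod_power2 by (simp add: power2_eq_square algebra_simps)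
  moreover have "0 < ((norm c)\<^sup>2 - 1) * ((norm a)\<^sup>2 - (norm b)\<^sup>2)"
    using assms by (intro mult_pos_pos) (auto intro: power_strict_mono)
  ultimately have "(norm (c * cnj b - a))\<^sup>2 < (norm (c * cnj a - b))\<^sup>2" by linarith
  hence "norm (c * cnj b - a) < norm (c * cnj a - b)" by (rule power2_less_imp_less) simp
  thus ?thesis by (simp add: norm_mult)
qed

text \<open>As \<open>norm x = 1\<close>, the denominator \<open>1 - cnj w * x\<close> at \<open>x\<close> has the same modulus as \<open>x - w\<close>, and \<open>w\<close> is
  the preimage of 0.\<close>

lemma moebius_distance_identity:
  assumes w: "norm w < 1" and x: "norm x = 1"
  shows "norm (Moebius_function t w 0 - Moebius_function t w x) * norm (w - x) =
           1 - (norm (Moebius_function t w 0))\<^sup>2"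
proof -
  have "norm (cnj w * x) < 1" using w x by (simp add: norm_mult)
  hence nz: "1 - cnj w * x \<noteq> 0" by auto
  have xx: "x * cnj x = 1" using x by (simp add: complex_norm_square[symmetric])
  have "(x - w) / (1 - cnj w * x) + w = x * (1 - w * cnj w) / (1 - cnj w * x)"
    using nz by (simp add: field_simps)
  moreover have "Moebius_function t w 0 - Moebius_function t w x =
           - (exp (\<i> * of_real t) * ((x - w) / (1 - cnj w * x) + w))"
    unfolding Moebius_function_def by (simp add: distrib_left)
  ultimately have "Moebius_function t w 0 - Moebius_function t w x =
           - (exp (\<i> * of_real t) * (x * (1 - w * cnj w) / (1 - cnj w * x)))"
    by (simp only:)
  hence "norm (Moebius_function t w 0 - Moebius_function t w x) =
           norm (1 - w * cnj w) / norm (1 - cnj w * x)"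
    using x by (simp add: norm_mult norm_divide)
  also have "1 - w * cnj w = of_real (1 - (norm w)\<^sup>2)" using complex_norm_square[of w] by simp
  also have "1 - cnj w * x = x * cnj (x - w)" using xx by (simp add: algebra_simps)
  also have "norm (x * cnj (x - w)) = norm (w - x)"
    using x by (simp only: norm_mult complex_mod_cnj norm_minus_commute mult_1)
  finally have "norm (Moebius_function t w 0 - Moebius_function t w x) =
      \<bar>1 - (norm w)\<^sup>2\<bar> / norm (w - x)" by (simp only: norm_of_real)
  moreover have "w \<noteq> x" using w x by auto
  moreover have "(norm w)\<^sup>2 \<le> 1" using w by (simp add: abs_square_le_1)
  ultimately show ?thesis by (simp add: Moebius_function_of_zero norm_mult)
qed

context cap_system
begin

lemma act_as_matrix:
  "\<exists>a b. norm b < norm a \<and> (\<forall>z\<in>cball 0 1.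
     act w z = (a * (if even (length w) then z else cnj z) + b) /
               (cnj b * (if even (length w) then z else cnj z) + cnj a))"
proof (induction w)
  case Nil
  show ?case by (intro exI[of _ 1] exI[of _ 0]) simp
next
  case (Cons i w)
  then obtain a b where ab: "norm b < norm a" and eq: "\<And>z. norm z \<le> 1 \<Longrightarrow>
     act w z = (a * (if even (length w) then z else cnj z) + b) /
               (cnj b * (if even (length w) then z else cnj z) + cnj a)"
    by auto
  let ?a = "\<i> * (c i * cnj a - b)" and ?b = "\<i> * (c i * cnj b - a)"
  have "act (i # w) z = (?a * (if even (length (i # w)) then z else cnj z) + ?b) /
               (cnj ?b * (if even (length (i # w)) then z else cnj z) + cnj ?a)" if z: "norm z \<le> 1" for z
  proof -
    define u where "u = (if even (length w) then z else cnj z)"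
    have "norm u \<le> 1" using z by (simp add: u_def)
    moreover have act: "act w z = (a * u + b) / (cnj b * u + cnj a)" using eq[OF z] by (simp add: u_def)
    moreover have "norm ((a * u + b) / (cnj b * u + cnj a)) \<le> 1"
      using norm_act_le_1[OF z, of w] act by simp
    ultimately have "act (i # w) z = (?a * cnj u + ?b) / (cnj ?b * cnj u + cnj ?a)"
      using reflection_of_matrix[OF norm_center ab, of u i] by (simp only: act.simps)
    moreover have "cnj u = (if even (length (i # w)) then z else cnj z)" by (simp add: u_def)
    ultimately show ?thesis by (simp only:)
  qed
  thus ?case using reflected_matrix_norm[OF norm_center[of i] ab] by (intro exI[of _ ?a] exI[of _ ?b]) auto
qed

lemma act_moebius:
  assumes "even (length w)"
  shows "\<exists>t a. norm a < 1 \<and> (\<forall>z\<in>cball 0 1. act w z = Moebius_function t a z)"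
proof -
  obtain a b where ab: "norm b < norm a"
    "\<And>z. norm z \<le> 1 \<Longrightarrow> act w z = (a * z + b) / (cnj b * z + cnj a)"
    using act_as_matrix[of w] assms by auto
  obtain t e where "norm e < 1" "\<And>z. Moebius_function t e z = (a * z + b) / (cnj b * z + cnj a)"
    using moebius_function_of_matrix[OF ab(1)] by blast
  thus ?thesis using ab(2) by (intro exI[of _ t] exI[of _ e]) auto
qed

lemma act_distance_identity:
  assumes w: "even (length w)" and p: "norm p = 1"
  shows "norm (act w 0 - p) * norm (act (rev w) 0 - act (rev w) p) = 1 - (norm (act w 0))\<^sup>2"
proof -
  obtain t a where a: "norm a < 1" and eq: "\<And>z. norm z \<le> 1 \<Longrightarrow> act w z = Moebius_function t a z"
    using act_moebius[OF w] by auto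
  have "act w a = 0" using eq[of a] a by (simp add: Moebius_function_eq_zero)
  hence "act (rev w) 0 = a" using act_rev_act[of w a] by simp
  moreover have x: "norm (act (rev w) p) = 1" using p by (rule norm_act_eq_1)
  ultimately show ?thesis
    using moebius_distance_identity[OF a x, of t] eq[of 0] eq[of "act (rev w) p"] by simp
qed

definition even_group :: "(complex \<Rightarrow> complex) set" where
  "even_group = {restrict (act w) (cball 0 1) | w. even (length w)}"

lemma act_in_Bij: "restrict (act w) (cball 0 1) \<in> Bij (cball 0 1)"
proof -
  have "bij_betw (act w) (cball 0 1) (cball 0 1)"
    by (rule bij_betw_byWitness[where f' = "act (rev w)"]) (auto intro: norm_act_le_1)
  thus ?thesis by (simp add: Bij_def bij_betw_restrict_eq)
qed

lemma mult_act:
  "restrict (act v) (cball 0 1) \<otimes>\<^bsub>BijGroup (cball 0 1)\<^esub> restrict (act w) (cball 0 1) =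
     restrict (act (v @ w)) (cball 0 1)"
  by (auto simp: BijGroup_def act_in_Bij compose_def fun_eq_iff norm_act_le_1)

lemma one_act: "\<one>\<^bsub>BijGroup (cball 0 1)\<^esub> = restrict (act []) (cball 0 1)"
  by (auto simp: BijGroup_def)

lemma inv_act:
  "inv\<^bsub>BijGroup (cball 0 1)\<^esub> restrict (act w) (cball 0 1) = restrict (act (rev w)) (cball 0 1)"
proof (rule group.inv_equality[OF group_BijGroup])
  show "restrict (act (rev w)) (cball 0 1) \<otimes>\<^bsub>BijGroup (cball 0 1)\<^esub> restrict (act w) (cball 0 1) =
          \<one>\<^bsub>BijGroup (cball 0 1)\<^esub>"
    unfolding mult_act one_act by auto
qed (auto simp: BijGroup_def act_in_Bij)

lemma subgroup_even_group: "subgroup even_group (BijGroup (cball 0 1))"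
proof (rule subgroup.intro)
  show "even_group \<subseteq> carrier (BijGroup (cball 0 1))"
    by (auto simp: even_group_def BijGroup_def act_in_Bij)
  show "x \<otimes>\<^bsub>BijGroup (cball 0 1)\<^esub> y \<in> even_group" if xy: "x \<in> even_group" "y \<in> even_group" for x y
  proof -
    obtain v w where "x = restrict (act v) (cball 0 1)" "y = restrict (act w) (cball 0 1)"
      "even (length v)" "even (length w)" using xy unfolding even_group_def by blast
    thus ?thesis unfolding even_group_def by (auto simp only: mult_act intro!: exI[of _ "v @ w"]) auto
  qed
  show "\<one>\<^bsub>BijGroup (cball 0 1)\<^esub> \<in> even_group"
    unfolding one_act even_group_def by (auto intro!: exI[of _ "[]"])
  show "inv\<^bsub>BijGroup (cball 0 1)\<^esub> x \<in> even_group" if x: "x \<in> even_group" for x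
  proof -
    obtain w where "x = restrict (act w) (cball 0 1)" "even (length w)"
      using x by (auto simp: even_group_def)
    thus ?thesis by (auto simp: inv_act even_group_def intro!: exI[of _ "rev w"])
  qed
qed

lemma reduced_word_moves_zero:
  assumes "distinct_adj w" "w \<noteq> []"
  shows "\<exists>i. act w 0 \<in> cap (c i)"
  using ping_pong[OF assms, of 0] zero_notin_cap notin_open_capI by auto

text \<open>The centers are bounded, so the caps avoid a disc around 0. If \<open>act w\<close> is close to \<open>act v\<close>, then the
  quotient moves 0 by less than the radius of that disc, and its reduced word is empty.\<close>

lemma discrete_even_group: "discrete_moebius even_group"
  unfolding discrete_moebius_def
proof
  fix f assume "f \<in> even_group"
  then obtain v where f: "f = restrict (act v) (cball 0 1)" by (auto simp: even_group_def)
  obtain K where K: "0 < K" "\<And>i. norm (c i) \<le> K"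
    using convergent_imp_Bseq[of c] centers_to_1 by (auto simp: convergent_def Bseq_def)
  have far: "1 \<le> 2 * norm z * K" if "z \<in> cap (c i)" for z i
  proof -
    have "1 \<le> 2 * norm z * norm (c i)" by (rule norm_ge_in_cap[OF that])
    also have "\<dots> \<le> 2 * norm z * K" by (intro mult_left_mono K) auto
    finally show ?thesis .
  qed
  define d where "d = 1 / (2 * K)"
  have d: "0 < d" using K by (simp add: d_def)
  have "act v 0 \<in> cball 0 1" by (simp add: norm_act_le_1)
  then obtain e where e: "0 < e" "\<And>x. x \<in> cball 0 1 \<Longrightarrow> dist x (act v 0) < e \<Longrightarrow>
      dist (act (rev v) x) (act (rev v) (act v 0)) < d"
    using continuous_on_act[of "rev v"] d unfolding continuous_on_iff by metis
  show "\<exists>e>0. \<forall>g\<in>even_group. (\<forall>z\<in>cball 0 1. dist (g z) (f z) < e) \<longrightarrow> g = f"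
  proof (intro exI[of _ e] conjI ballI impI e(1))
    fix g assume g: "g \<in> even_group" "\<forall>z\<in>cball 0 1. dist (g z) (f z) < e"
    then obtain w where w: "g = restrict (act w) (cball 0 1)" by (auto simp: even_group_def)
    have "dist (act w 0) (act v 0) < e" using g(2) by (auto simp: w f dest!: bspec[of _ _ 0])
    hence "norm (act (rev v @ w) 0) < d" using e(2)[of "act w 0"] by (simp add: norm_act_le_1)
    moreover obtain u where u: "distinct_adj u" "act u = act (rev v @ w)"
      using exists_reduced_word by blast
    ultimately have small: "norm (act u 0) < d" by (simp only:)
    have "u = []"
    proof (rule ccontr)
      assume "u \<noteq> []"
      then obtain i where "act u 0 \<in> cap (c i)" using reduced_word_moves_zero u(1) by blast
      hence "1 \<le> 2 * norm (act u 0) * K" by (rule far)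
      thus False using small K(1) by (simp add: d_def field_simps)
    qed
    hence "act (rev v) (act w z) = z" for z using u(2) by (metis act.simps(1) act_append)
    hence "act w z = act v z" for z by (metis act_act_rev)
    thus "g = f" by (auto simp: w f)
  qed
qed

lemma fuchsian_group: "fuchsian_group even_group"
proof -
  have "even_group \<subseteq> disc_moebius"
  proof
    fix g assume "g \<in> even_group"
    then obtain w where w: "g = restrict (act w) (cball 0 1)" "even (length w)" by (auto simp: even_group_def)
    then obtain t a where "norm a < 1" "\<forall>z\<in>cball 0 1. act w z = Moebius_function t a z"
      using act_moebius by blast
    moreover from this have "g = restrict (Moebius_function t a) (cball 0 1)"
      using w by (auto intro: restrict_ext)
    ultimately show "g \<in> disc_moebius" unfolding disc_moebius_def by blast
  qed
  thus ?thesis using subgroup_even_group discrete_even_group by (simp add: fuchsian_group_def)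
qed

text \<open>Finitely many generators use letters below some \<open>N\<close>, and their products send 0 into caps with index
  below \<open>N\<close> or fix it. But the element \<open>[N, N + 1]\<close> of the group sends 0 into the cap of index \<open>N\<close>.\<close>

lemma not_finitely_generated: "\<not> finitely_generated even_group"
proof
  assume "finitely_generated even_group"
  then obtain S where S: "finite S" "S \<subseteq> even_group" "generate (BijGroup (cball 0 1)) S = even_group"
    by (auto simp: finitely_generated_def)
  have "\<forall>g\<in>S. \<exists>w. g = restrict (act w) (cball 0 1)" using S by (auto simp: even_group_def)
  then obtain W where W: "\<And>g. g \<in> S \<Longrightarrow> g = restrict (act (W g)) (cball 0 1)" by metis
  define N where "N = Suc (Max (insert 0 (\<Union>g\<in>S. set (W g))))"
  have fin: "finite (insert 0 (\<Union>g\<in>S. set (W g)))" using S(1) by auto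
  have letters: "i < N" if "g \<in> S" "i \<in> set (W g)" for g i
    unfolding N_def less_Suc_eq_le using that by (intro Max_ge fin) auto
  have bounded: "\<exists>w. g = restrict (act w) (cball 0 1) \<and> set w \<subseteq> {..<N}"
    if "g \<in> generate (BijGroup (cball 0 1)) S" for g
    using that
  proof induction
    case one
    thus ?case by (auto simp: one_act intro!: exI[of _ "[]"])
  next
    case (incl h)
    thus ?case using W letters by blast
  next
    case (inv h)
    have "inv\<^bsub>BijGroup (cball 0 1)\<^esub> h = restrict (act (rev (W h))) (cball 0 1)"
      using W[OF inv] inv_act by metis
    thus ?case using letters[OF inv] by (intro exI[of _ "rev (W h)"]) auto
  next
    case (eng g h)
    then obtain v w where "g = restrict (act v) (cball 0 1)" "h = restrict (act w) (cball 0 1)"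
      "set v \<subseteq> {..<N}" "set w \<subseteq> {..<N}" by blast
    thus ?case by (intro exI[of _ "v @ w"]) (auto simp only: mult_act set_append)
  qed
  have "restrict (act [N, Suc N]) (cball 0 1) \<in> even_group" by (auto simp: even_group_def intro!: exI[of _ "[N, Suc N]"])
  then obtain w where w: "restrict (act [N, Suc N]) (cball 0 1) = restrict (act w) (cball 0 1)"
    "set w \<subseteq> {..<N}" using bounded S(3) by blast
  obtain v where v: "distinct_adj v" "set v \<subseteq> set w" "act v = act w" using exists_reduced_word by blast
  have "act [N, Suc N] 0 = act v 0"
    using fun_cong[OF w(1), of 0] by (simp add: v(3))
  moreover have "act [N, Suc N] 0 \<in> cap (c N)"
    using ping_pong[of "[N, Suc N]" 0] zero_notin_cap notin_open_capI by simp
  ultimately have *: "act v 0 \<in> cap (c N)" by metis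
  show False
  proof (cases "v = []")
    case False
    hence "act v 0 \<in> cap (c (hd v))"
      using ping_pong[of v 0] v zero_notin_cap notin_open_capI by simp
    hence "N = hd v" using * same_cap by blast
    moreover have "hd v < N" using v(2) w(2) False by (auto dest: hd_in_set)
    ultimately show False by simp
  qed (use * zero_notin_cap in simp)
qed

lemma cap_nonempty: "cap (c i) \<noteq> {}"
  using cap_meets_sphere[OF norm_center, of i] by auto

text \<open>If the extreme letters differ, the word maps the cap of its first letter into itself, and this cap is
  convex and compact.\<close>

lemma fixed_point_in_cap:
  assumes "distinct_adj w" "w \<noteq> []" "hd w \<noteq> last w"
  shows "\<exists>z\<in>cap (c (hd w)). act w z = z"
proof -
  have "act w \<in> cap (c (hd w)) \<rightarrow> cap (c (hd w))"
    using assms by (auto intro!: ping_pong notin_open_capI norm_le_1_if_cap dest: same_cap)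
  moreover have "continuous_on (cap (c (hd w))) (act w)"
    by (rule continuous_on_subset[OF continuous_on_act cap_subset_disc])
  ultimately show ?thesis
    using brouwer[OF convex_compact_cap(2,1) cap_nonempty, of "hd w" "act w"] by blast
qed

text \<open>Conjugation by the common extreme letter shortens the word until its extreme letters differ. Then
  the word and its inverse have fixed points in two disjoint caps.\<close>

lemma two_fixed_points:
  assumes "distinct_adj w" "even (length w)"
  shows "\<exists>x y. x \<noteq> y \<and> norm x \<le> 1 \<and> norm y \<le> 1 \<and> act w x = x \<and> act w y = y"
  using assms
proof (induction "length w" arbitrary: w rule: less_induct)
  case less
  show ?case
  proof (cases "w = []")
    case True
    thus ?thesis by (intro exI[of _ 0] exI[of _ 1]) auto
  next
    case ne: False
    show ?thesis
    proof (cases "hd w = last w")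
      case False
      obtain x where x: "x \<in> cap (c (hd w))" "act w x = x"
        using fixed_point_in_cap less.prems ne False by blast
      obtain y where y: "y \<in> cap (c (last w))" "act (rev w) y = y"
        using fixed_point_in_cap[of "rev w"] less.prems ne False by (auto simp: hd_rev last_rev)
      have "act w y = y" using y(2) act_act_rev[of w y] by simp
      moreover have "x \<noteq> y" using x(1) y(1) False same_cap by blast
      ultimately show ?thesis using x y norm_le_1_if_cap by blast
    next
      case True
      then obtain i u where u: "w = i # u" using ne by (cases w) auto
      have "u \<noteq> []" using less.prems(2) u by auto
      then obtain v where v: "w = i # v @ [i]" using True u by (metis append_butlast_last_id last_ConsR list.sel(1))
      obtain x y where xy: "x \<noteq> y" "norm x \<le> 1" "norm y \<le> 1" "act v x = x" "act v y = y"
        using less.hyps[of v] less.prems v by (auto simp: distinct_adj_Cons distinct_adj_append_iff)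
      show ?thesis
      proof (intro exI conjI)
        show "reflection (c i) x \<noteq> reflection (c i) y"
          using xy(1) by (metis reflection_reflection norm_center)
      qed (use xy in \<open>auto simp: v norm_center intro: norm_reflection_le_1\<close>)
    qed
  qed
qed

lemma not_parabolic:
  assumes "g \<in> even_group"
  shows "\<not> parabolic g"
proof
  assume par: "parabolic g"
  obtain w where w: "g = restrict (act w) (cball 0 1)" "even (length w)"
    using assms by (auto simp: even_group_def)
  obtain v where "distinct_adj v" "even (length v)" "act v = act w"
    using exists_reduced_word[of w] w(2) by blast
  then obtain x y where xy: "x \<noteq> y" "norm x \<le> 1" "norm y \<le> 1" "act w x = x" "act w y = y"
    using two_fixed_points by metis
  hence "g x = x" "g y = y" by (auto simp: w)
  moreover have "norm z = 1" if "g z = z" "norm z \<le> 1" for z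
  proof (rule ccontr)
    assume "norm z \<noteq> 1"
    hence "z \<in> ball 0 1" using that(2) by simp
    thus False using par that(1) unfolding parabolic_def by blast
  qed
  ultimately have "x \<in> sphere 0 1 \<and> g x = x" "y \<in> sphere 0 1 \<and> g y = y" using xy by auto
  moreover have "\<exists>!p. p \<in> sphere 0 1 \<and> g p = p" using par unfolding parabolic_def by blast
  ultimately show False using xy(1) by blast
qed

end

section \<open>Conical limit points are nontangential limits of the orbit of 0\<close>

lemma cosh_hyperbolic_dist:
  assumes "norm z < 1" "norm w < 1"
  shows "cosh (hyperbolic_dist z w) = 1 + 2 * (norm (z - w))\<^sup>2 / ((1 - (norm z)\<^sup>2) * (1 - (norm w)\<^sup>2))"
proof -
  have "(norm z)\<^sup>2 \<le> 1" "(norm w)\<^sup>2 \<le> 1" using assms by (auto simp: abs_square_le_1)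
  thus ?thesis unfolding hyperbolic_dist_def by (intro cosh_arcosh_real) auto
qed

lemma one_minus_norm_power2_pos: "norm z < 1 \<Longrightarrow> 0 < 1 - (norm z)\<^sup>2"
  by (simp add: abs_square_less_1)

text \<open>After the substitution \<open>x = s / 2\<close>, \<open>y = t / 2\<close> the argument of \<open>arcosh\<close> becomes
  \<open>1 + 2 (sinh (x - y))\<^sup>2 = cosh (s - t)\<close>.\<close>

lemma radial_geodesic_ray:
  assumes p: "norm p = 1"
  shows "geodesic_ray_to (\<lambda>t. of_real (tanh (t / 2)) * p) p"
  unfolding geodesic_ray_to_def
proof (intro conjI allI impI)
  fix t :: real
  have tanh: "\<bar>tanh x\<bar> < 1" for x :: real using tanh_real_bounds[of x] by auto
  show "of_real (tanh (t / 2)) * p \<in> ball 0 1" using tanh p by (simp add: norm_mult)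
next
  fix s t :: real
  define x where "x = s / 2"
  define y where "y = t / 2"
  have sech: "1 - (tanh u)\<^sup>2 = 1 / (cosh u)\<^sup>2" for u :: real
  proof -
    have "1 - (tanh u)\<^sup>2 = ((cosh u)\<^sup>2 - (sinh u)\<^sup>2) / (cosh u)\<^sup>2"
      using cosh_real_pos[of u] by (simp add: tanh_def power_divide diff_divide_distrib del: hyperbolic_pythagoras)
    thus ?thesis by (simp only: hyperbolic_pythagoras)
  qed
  have diff: "tanh x - tanh y = sinh (x - y) / (cosh x * cosh y)"
    unfolding tanh_def sinh_diff using cosh_real_pos[of x] cosh_real_pos[of y] by (simp add: field_simps)
  have *: "(tanh x - tanh y)\<^sup>2 / (1 / (cosh x)\<^sup>2 * (1 / (cosh y)\<^sup>2)) = (sinh (x - y))\<^sup>2"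
    unfolding diff using cosh_real_pos[of x] cosh_real_pos[of y]
    by (simp add: power_divide power_mult_distrib)
  have nrm: "norm (of_real a * p) = \<bar>a\<bar>" for a :: real using p by (simp add: norm_mult)
  have "of_real (tanh x) * p - of_real (tanh y) * p = of_real (tanh x - tanh y) * p"
    by (simp add: left_diff_distrib)
  hence "hyperbolic_dist (of_real (tanh x) * p) (of_real (tanh y) * p) =
      arcosh (1 + 2 * (tanh x - tanh y)\<^sup>2 / ((1 - (tanh x)\<^sup>2) * (1 - (tanh y)\<^sup>2)))"
    unfolding hyperbolic_dist_def by (simp only: nrm power2_abs)
  also have "1 + 2 * (tanh x - tanh y)\<^sup>2 / ((1 - (tanh x)\<^sup>2) * (1 - (tanh y)\<^sup>2)) = 1 + 2 * (sinh (x - y))\<^sup>2"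
    unfolding sech using * by (metis times_divide_eq_right)
  also have "\<dots> = cosh (2 * (x - y))"
    using cosh_add[of "x - y" "x - y"] cosh_square_eq[of "x - y"] unfolding mult_2
    by (simp add: power2_eq_square)
  also have "\<dots> = cosh \<bar>s - t\<bar>" by (simp add: x_def y_def)
  also have "arcosh \<dots> = \<bar>s - t\<bar>" by (rule arcosh_cosh_real) simp
  finally show "hyperbolic_dist (of_real (tanh (s / 2)) * p) (of_real (tanh (t / 2)) * p) = \<bar>s - t\<bar>"
    by (simp only: x_def y_def)
next
  have "((\<lambda>t::real. tanh (t / 2)) \<longlongrightarrow> 1) at_top"
    by (rule filterlim_compose[OF tanh_real_at_top]) real_asymp
  hence "((\<lambda>t. of_real (tanh (t / 2)) * p) \<longlongrightarrow> of_real 1 * p) at_top"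
    by (intro tendsto_intros)
  thus "((\<lambda>t. of_real (tanh (t / 2)) * p) \<longlongrightarrow> p) at_top" by simp
qed

text \<open>The point of the radius towards \<open>p\<close> with the same modulus as \<open>z\<close> is close enough.\<close>

lemma near_radius_if_nontangential:
  assumes z: "norm z < 1" and p: "norm p = 1" and M: "norm (z - p) \<le> M * (1 - (norm z)\<^sup>2)"
  shows "\<exists>t\<ge>0. hyperbolic_dist z (of_real (tanh (t / 2)) * p) \<le> arcosh (1 + 2 * (M + 1)\<^sup>2)"
proof -
  define q where "q = 1 - (norm z)\<^sup>2"
  have q: "0 < q" unfolding q_def using z by (rule one_minus_norm_power2_pos)
  obtain t :: real where t: "0 \<le> t" "tanh (t / 2) = norm z"
  proof -
    \<comment> \<open>The value \<open>artanh (norm z)\<close>, written out.\<close>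
    define u where "u = ln ((1 + norm z) / (1 - norm z)) / 2"
    have pos: "0 < 1 + norm z" "0 < 1 - norm z" using z norm_ge_zero[of z] by linarith+
    hence e: "exp (- 2 * u) = (1 - norm z) / (1 + norm z)" by (simp add: u_def exp_minus)
    have "1 - exp (- 2 * u) = 2 * norm z / (1 + norm z)" "1 + exp (- 2 * u) = 2 / (1 + norm z)"
      unfolding e using pos by (auto simp: field_simps)
    hence u: "tanh u = norm z" unfolding tanh_real_altdef using pos by simp
    hence "0 \<le> u" by (metis norm_ge_zero tanh_real_nonneg_iff)
    thus thesis using u by (intro that[of "2 * u"]) auto
  qed
  define w where "w = of_real (norm z) * p"
  have w: "norm w = norm z" using p by (simp add: w_def norm_mult)
  have "norm (z - w) \<le> norm (z - p) + norm (p - w)"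
    using norm_triangle_ineq[of "z - p" "p - w"] by simp
  also have "p - w = of_real (1 - norm z) * p" by (simp add: w_def left_diff_distrib)
  also have "norm \<dots> = 1 - norm z" using p z by (simp only: norm_mult norm_of_real) simp
  also have "1 - norm z \<le> q" using z by (simp add: q_def power2_eq_square mult_left_le)
  finally have "norm (z - w) \<le> (M + 1) * q" using M by (simp add: q_def[symmetric] algebra_simps)
  hence "(norm (z - w))\<^sup>2 \<le> ((M + 1) * q)\<^sup>2" by (rule power_mono) simp
  hence "2 * (norm (z - w))\<^sup>2 / (q * q) \<le> 2 * (M + 1)\<^sup>2"
    using q by (simp add: field_simps power2_eq_square)
  hence "hyperbolic_dist z w \<le> arcosh (1 + 2 * (M + 1)\<^sup>2)"
  proof -
    assume le: "2 * (norm (z - w))\<^sup>2 / (q * q) \<le> 2 * (M + 1)\<^sup>2"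
    have "0 \<le> 2 * (norm (z - w))\<^sup>2 / (q * q)" using q by simp
    hence "arcosh (1 + 2 * (norm (z - w))\<^sup>2 / (q * q)) \<le> arcosh (1 + 2 * (M + 1)\<^sup>2)"
      using le arcosh_less_iff_real[of "1 + 2 * (M + 1)\<^sup>2" "1 + 2 * (norm (z - w))\<^sup>2 / (q * q)"] by linarith
    thus ?thesis by (simp add: hyperbolic_dist_def w q_def)
  qed
  thus ?thesis using t by (intro exI[of _ t]) (simp add: w_def)
qed

text \<open>An arbitrary geodesic ray is accessible only through its distance function. Comparing \<open>cosh (t - s)\<close>
  with \<open>cosh t\<close> as \<open>t\<close> tends to infinity bounds the horocyclic quantity \<open>(norm (r s - p))\<^sup>2 / (1 - (norm (r s))\<^sup>2)\<close>
  by a multiple of \<open>exp (- s)\<close>, and \<open>cosh s \<le> exp s\<close> bounds \<open>(norm (r 0 - r s))\<^sup>2 / (1 - (norm (r s))\<^sup>2)\<close>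
  by a multiple of \<open>exp s\<close>. In the product the exponentials cancel.\<close>

lemma geodesic_ray_nontangential:
  assumes r: "geodesic_ray_to r p" and p: "norm p = 1" and s: "0 \<le> s"
  shows "norm (r s - p) * norm (r 0 - r s) \<le> norm (r 0 - p) * (1 - (norm (r s))\<^sup>2)"
proof -
  have ball: "norm (r t) < 1" if "0 \<le> t" for t using r that by (auto simp: geodesic_ray_to_def)
  define h where "h = (\<lambda>t. 1 - (norm (r t))\<^sup>2)"
  have h: "0 < h t" if "0 \<le> t" for t unfolding h_def using ball[OF that] by (rule one_minus_norm_power2_pos)
  have cosh: "cosh (t - u) = 1 + 2 * (norm (r u - r t))\<^sup>2 / (h u * h t)" if "0 \<le> t" "0 \<le> u" for t u
  proof -
    have "hyperbolic_dist (r u) (r t) = \<bar>u - t\<bar>" using r that by (auto simp: geodesic_ray_to_def)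
    hence "cosh (hyperbolic_dist (r u) (r t)) = cosh (t - u)" by (simp add: abs_minus_commute)
    thus ?thesis using cosh_hyperbolic_dist[OF ball[OF that(2)] ball[OF that(1)]] by (simp add: h_def)
  qed
  have lim: "(r \<longlongrightarrow> p) at_top" using r by (simp add: geodesic_ray_to_def)
  have h0: "(h \<longlongrightarrow> 0) at_top"
  proof -
    have "(h \<longlongrightarrow> 1 - (norm p)\<^sup>2) at_top" unfolding h_def by (intro tendsto_intros lim)
    thus ?thesis using p by simp
  qed
  \<comment> \<open>Busemann function of \<open>p\<close> along the ray, in the limit of \<open>h t * cosh (t - s) \<le> 2 * exp (- s) * (h t * cosh t)\<close>.\<close>
  have horo: "2 * (norm (r s - p))\<^sup>2 / h s \<le> exp (- s) * (4 * (norm (r 0 - p))\<^sup>2 / h 0)"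
  proof (rule tendsto_le[of at_top])
    show "((\<lambda>t. h t + 2 * (norm (r s - r t))\<^sup>2 / h s) \<longlongrightarrow> 2 * (norm (r s - p))\<^sup>2 / h s) at_top"
    proof -
      have "((\<lambda>t. h t + 2 * (norm (r s - r t))\<^sup>2 / h s) \<longlongrightarrow> 0 + 2 * (norm (r s - p))\<^sup>2 / h s) at_top"
        using h[OF s] by (intro tendsto_intros lim h0) auto
      thus ?thesis by simp
    qed
    show "((\<lambda>t. exp (- s) * (2 * h t + 4 * (norm (r 0 - r t))\<^sup>2 / h 0)) \<longlongrightarrow>
            exp (- s) * (4 * (norm (r 0 - p))\<^sup>2 / h 0)) at_top"
    proof -
      have "((\<lambda>t. exp (- s) * (2 * h t + 4 * (norm (r 0 - r t))\<^sup>2 / h 0)) \<longlongrightarrow>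
            exp (- s) * (2 * 0 + 4 * (norm (r 0 - p))\<^sup>2 / h 0)) at_top"
        using h[of 0] by (intro tendsto_intros lim h0) auto
      thus ?thesis by simp
    qed
    show "\<forall>\<^sub>F t in at_top. h t + 2 * (norm (r s - r t))\<^sup>2 / h s \<le>
            exp (- s) * (2 * h t + 4 * (norm (r 0 - r t))\<^sup>2 / h 0)"
      using eventually_ge_at_top[of s]
    proof eventually_elim
      case (elim t)
      have t: "0 \<le> t" using elim s by simp
      have "cosh (t - s) \<le> exp (t - s)"
        unfolding cosh_field_def using elim by simp
      also have "\<dots> = exp (- s) * exp t" by (simp add: exp_diff exp_minus field_simps)
      also have "\<dots> \<le> exp (- s) * (2 * cosh t)" unfolding cosh_field_def by simp
      finally have "h t * cosh (t - s) \<le> h t * (exp (- s) * (2 * cosh t))"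
        using h[OF t] by (intro mult_left_mono) auto
      moreover have "h t * cosh (t - s) = h t + 2 * (norm (r s - r t))\<^sup>2 / h s"
        using cosh[OF t s] h[OF t] h[OF s] by (simp add: field_simps)
      moreover have "h t * cosh t = h t + 2 * (norm (r 0 - r t))\<^sup>2 / h 0"
        using cosh[OF t, of 0] h[OF t] h[of 0] by (simp add: field_simps)
      moreover have "h t * (exp (- s) * (2 * cosh t)) = exp (- s) * (2 * (h t * cosh t))" by simp
      ultimately show ?case by (simp add: distrib_left)
    qed
  qed simp
  have "1 + 2 * (norm (r 0 - r s))\<^sup>2 / (h 0 * h s) \<le> exp s"
  proof -
    have "cosh s \<le> exp s" unfolding cosh_field_def using s by simp
    thus ?thesis using cosh[OF s, of 0] by simp
  qed
  hence "2 * (norm (r 0 - r s))\<^sup>2 / (h 0 * h s) \<le> exp s" by simp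
  hence a: "2 * (norm (r 0 - r s))\<^sup>2 \<le> exp s * (h 0 * h s)"
    using h[OF s] h[of 0] by (simp add: pos_divide_le_eq)
  have b: "2 * (norm (r s - p))\<^sup>2 \<le> exp (- s) * (4 * (norm (r 0 - p))\<^sup>2 / h 0) * h s"
    using horo h[OF s] by (simp add: pos_divide_le_eq)
  have "(2 * (norm (r s - p))\<^sup>2) * (2 * (norm (r 0 - r s))\<^sup>2) \<le>
          (exp (- s) * (4 * (norm (r 0 - p))\<^sup>2 / h 0) * h s) * (exp s * (h 0 * h s))"
    by (rule mult_mono[OF b a]) (use h[OF s] h[of 0] in auto)
  also have "\<dots> = 4 * (norm (r 0 - p))\<^sup>2 * (h s)\<^sup>2"
    using h[of 0] by (simp add: exp_minus field_simps power2_eq_square)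
  finally have "(norm (r s - p) * norm (r 0 - r s))\<^sup>2 \<le> (norm (r 0 - p) * h s)\<^sup>2"
    by (simp add: power_mult_distrib)
  hence "norm (r s - p) * norm (r 0 - r s) \<le> norm (r 0 - p) * h s"
    by (rule power2_le_imp_le) (use h[OF s] in auto)
  thus ?thesis by (simp add: h_def)
qed

text \<open>With \<open>a\<close>, \<open>b\<close> the two defects \<open>1 - (norm z)\<^sup>2\<close>, \<open>1 - (norm w)\<^sup>2\<close>, bounded hyperbolic distance means
  \<open>(norm (z - w))\<^sup>2 \<le> K a b\<close>. As \<open>b - a \<le> 2 norm (z - w)\<close>, this is a quadratic inequality for \<open>b / a\<close>.\<close>

lemma bounded_hyperbolic_dist:
  assumes z: "norm z < 1" and w: "norm w < 1" and C: "hyperbolic_dist z w \<le> C"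
  shows "1 - (norm w)\<^sup>2 \<le> 2 * cosh C * (1 - (norm z)\<^sup>2)" "norm (z - w) \<le> 2 * cosh C * (1 - (norm z)\<^sup>2)"
proof -
  define a where "a = 1 - (norm z)\<^sup>2"
  define b where "b = 1 - (norm w)\<^sup>2"
  define d where "d = norm (z - w)"
  define K where "K = cosh C"
  have ab: "0 < a" "0 < b" unfolding a_def b_def using one_minus_norm_power2_pos z w by auto
  have K: "1 \<le> K" unfolding K_def by (rule cosh_real_ge_1)
  have nonneg: "0 \<le> hyperbolic_dist z w" unfolding hyperbolic_dist_def
    using ab by (intro arcosh_nonneg_real) (auto simp: a_def b_def)
  have "cosh (hyperbolic_dist z w) \<le> K"
    unfolding K_def using C nonneg by (subst cosh_real_nonneg_le_iff) auto
  hence "2 * d\<^sup>2 / (a * b) \<le> K - 1" using cosh_hyperbolic_dist[OF z w] by (simp add: a_def b_def d_def)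
  hence d: "2 * d\<^sup>2 \<le> (K - 1) * (a * b)" using ab by (simp add: pos_divide_le_eq)
  have "b - a = (norm z + norm w) * (norm z - norm w)" by (simp add: a_def b_def power2_eq_square algebra_simps)
  also have "\<dots> \<le> 2 * d"
    unfolding d_def using z w norm_triangle_ineq2[of z w]
    by (intro order_trans[OF mult_left_mono[of "norm z - norm w" "norm (z - w)"] mult_right_mono]) auto
  finally have ba: "b - a \<le> 2 * d" .
  show b: "1 - (norm w)\<^sup>2 \<le> 2 * cosh C * (1 - (norm z)\<^sup>2)"
  proof (cases "b \<le> a")
    case True
    have "a \<le> 2 * K * a" using ab K by simp
    thus ?thesis unfolding a_def[symmetric] b_def[symmetric] K_def[symmetric] using True by linarith
  next
    case False
    hence "(b - a)\<^sup>2 \<le> (2 * d)\<^sup>2" using ba by (intro power_mono) auto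
    hence "b * b + a * a \<le> 2 * a * b + 4 * d\<^sup>2" by (simp add: power2_eq_square algebra_simps)
    also have "\<dots> \<le> 2 * a * b + 2 * ((K - 1) * (a * b))" using d by linarith
    also have "\<dots> = (2 * K * a) * b" by (simp add: algebra_simps)
    finally have "b * b \<le> (2 * K * a) * b" using mult_pos_pos[OF ab(1) ab(1)] by linarith
    hence "b \<le> 2 * K * a" using ab(2) by (rule mult_right_le_imp_le)
    thus ?thesis by (simp add: a_def b_def K_def)
  qed
  have "d\<^sup>2 \<le> (2 * K * a)\<^sup>2"
  proof -
    have "2 * d\<^sup>2 \<le> K * (a * (2 * K * a))"
      using b ab K by (intro order_trans[OF d] mult_mono) (auto simp: a_def[symmetric] b_def[symmetric] K_def[symmetric])
    also have "\<dots> \<le> 2 * (2 * K * a)\<^sup>2" 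
      using ab K by (auto simp: power2_eq_square intro!: mult_nonneg_nonneg)
    finally show ?thesis by simp
  qed
  hence "d \<le> 2 * K * a" by (rule power2_le_imp_le) (use ab K in auto)
  thus "norm (z - w) \<le> 2 * cosh C * (1 - (norm z)\<^sup>2)" by (simp add: d_def a_def K_def)
qed

lemma conical_limit_pointI:
  assumes "limit_point \<Gamma> p" "\<And>n. \<gamma> n \<in> \<Gamma>" "(\<lambda>n. \<gamma> n 0) \<longlonglongrightarrow> p" "\<And>n. norm (\<gamma> n 0) < 1"
    and "\<And>n. norm (\<gamma> n 0 - p) \<le> M * (1 - (norm (\<gamma> n 0))\<^sup>2)"
  shows "conical_limit_point \<Gamma> p"
proof -
  have p: "norm p = 1" using assms(1) by (simp add: limit_point_def)
  show ?thesis unfolding conical_limit_point_def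
    using assms radial_geodesic_ray[OF p] near_radius_if_nontangential[OF _ p]
    by (intro conjI exI[of _ \<gamma>] exI[of _ "\<lambda>t. of_real (tanh (t / 2)) * p"] exI[of _ "arcosh (1 + 2 * (M + 1)\<^sup>2)"]) auto
qed

text \<open>The ray is nontangential near \<open>p\<close>, and points at bounded hyperbolic distance from it inherit this with
  a worse constant. Only orbit points near \<open>p\<close> are controlled, because the estimate for the ray
  degenerates near its origin.\<close>

lemma conical_limit_point_nontangential:
  assumes con: "conical_limit_point \<Gamma> p" and ball: "\<And>g. g \<in> \<Gamma> \<Longrightarrow> norm (g 0) < 1"
  shows "\<exists>\<gamma> M. (\<forall>n::nat. \<gamma> n \<in> \<Gamma>) \<and> (\<lambda>n. \<gamma> n 0) \<longlonglongrightarrow> p \<and>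
           (\<forall>\<^sub>F n in sequentially. norm (\<gamma> n 0 - p) \<le> M * (1 - (norm (\<gamma> n 0))\<^sup>2))"
proof -
  have p: "norm p = 1" using con by (simp add: conical_limit_point_def limit_point_def)
  obtain \<gamma> r C where \<gamma>: "\<And>n::nat. \<gamma> n \<in> \<Gamma>" "(\<lambda>n. \<gamma> n 0) \<longlonglongrightarrow> p" and r: "geodesic_ray_to r p"
    and C: "\<And>n. \<exists>t\<ge>0. hyperbolic_dist (\<gamma> n 0) (r t) \<le> C"
    using con by (auto simp: conical_limit_point_def)
  define d where "d = norm (r 0 - p)"
  have r_ball: "norm (r t) < 1" if "0 \<le> t" for t using r that by (auto simp: geodesic_ray_to_def)
  have d: "0 < d" using r_ball[of 0] p by (auto simp: d_def)
  have "(\<lambda>n. 2 * cosh C * (1 - (norm (\<gamma> n 0))\<^sup>2)) \<longlonglongrightarrow> 2 * cosh C * (1 - (norm p)\<^sup>2)"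
    by (intro tendsto_intros \<gamma>)
  hence "(\<lambda>n. 2 * cosh C * (1 - (norm (\<gamma> n 0))\<^sup>2)) \<longlonglongrightarrow> 0" using p by simp
  hence "\<forall>\<^sub>F n in sequentially. 2 * cosh C * (1 - (norm (\<gamma> n 0))\<^sup>2) < d / 4"
    by (rule order_tendstoD(2)) (use d in simp)
  moreover have "\<forall>\<^sub>F n in sequentially. dist (\<gamma> n 0) p < d / 4"
    using d \<gamma>(2) by (intro tendstoD) auto
  ultimately have "\<forall>\<^sub>F n in sequentially. norm (\<gamma> n 0 - p) \<le> 6 * cosh C * (1 - (norm (\<gamma> n 0))\<^sup>2)"
  proof eventually_elim
    case (elim n)
    define z where "z = \<gamma> n 0"
    define a where "a = 1 - (norm z)\<^sup>2"
    obtain t where t: "0 \<le> t" "hyperbolic_dist z (r t) \<le> C" using C z_def by blast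
    have z: "norm z < 1" using ball \<gamma>(1) by (simp add: z_def)
    note near = bounded_hyperbolic_dist[OF z r_ball[OF t(1)] t(2), folded a_def]
    have "d \<le> norm (r 0 - r t) + norm (z - r t) + norm (z - p)"
      unfolding d_def using norm_triangle_ineq[of "r 0 - r t" "r t - p"] norm_triangle_ineq[of "r t - z" "z - p"]
      by (simp add: norm_minus_commute)
    hence "d / 2 \<le> norm (r 0 - r t)" using elim near(2) by (simp add: z_def a_def dist_norm)
    hence "norm (r t - p) * (d / 2) \<le> norm (r t - p) * norm (r 0 - r t)" by (intro mult_left_mono) auto
    also have "\<dots> \<le> d * (1 - (norm (r t))\<^sup>2)"
      unfolding d_def by (rule geodesic_ray_nontangential[OF r p t(1)])
    also have "\<dots> \<le> d * (2 * cosh C * a)" using d near(1) by (intro mult_left_mono) auto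
    finally have "d * norm (r t - p) \<le> d * (4 * cosh C * a)" by (simp add: algebra_simps)
    hence "norm (r t - p) \<le> 4 * cosh C * a" using d by (simp add: mult_le_cancel_left_pos)
    moreover have "norm (z - p) \<le> norm (z - r t) + norm (r t - p)"
      using norm_triangle_ineq[of "z - r t" "r t - p"] by simp
    ultimately show ?case using near(2) by (simp add: z_def a_def)
  qed
  thus ?thesis using \<gamma> by blast
qed

section \<open>Limit points described by their codes\<close>

lemma circle_nbhd_ball:
  assumes "circle_nbhd V p"
  obtains e where "0 < e" "\<And>x. norm x = 1 \<Longrightarrow> dist x p < e \<Longrightarrow> x \<in> V"
proof -
  have "openin (top_of_set (sphere 0 1)) V" "p \<in> V" using assms by (auto simp: circle_nbhd_def)
  then obtain e where "0 < e" "ball p e \<inter> sphere 0 1 \<subseteq> V" unfolding openin_contains_ball by blast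
  thus thesis by (intro that[of e]) (auto simp: dist_commute)
qed

lemma image_restrict_subset: "A \<subseteq> D \<Longrightarrow> restrict f D ` A = f ` A"
  by (rule image_cong) auto

context cap_system
begin

lemma norm_act_less_1: "norm z < 1 \<Longrightarrow> norm (act w z) < 1"
  by (induction w) (auto intro: norm_reflection_less_1 norm_center)

lemma act_in_even_group: "even (length w) \<Longrightarrow> restrict (act w) (cball 0 1) \<in> even_group"
  by (auto simp: even_group_def)

lemma act_prefix_tendsto:
  assumes "\<And>n. s n \<noteq> s (Suc n)" "codes s p" "\<And>N. \<exists>k. N \<le> s k"
  shows "(\<lambda>n. act (prefix s n) 0) \<longlonglongrightarrow> p"
proof (rule tendstoI)
  fix e :: real assume "0 < e"
  then obtain K where "\<And>n. K < n \<Longrightarrow> dist (act (prefix s n) 0) p < e"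
    using act_prefix_near[OF assms \<open>0 < e\<close>] zero_notin_cap notin_open_capI by (metis norm_zero zero_le_one)
  thus "\<forall>\<^sub>F n in sequentially. dist (act (prefix s n) 0) p < e"
    unfolding eventually_sequentially by (intro exI[of _ "Suc K"]) auto
qed

lemma limit_point_if_coded:
  assumes "\<And>n. s n \<noteq> s (Suc n)" "codes s p" "\<And>N. \<exists>k. N \<le> s k"
  shows "limit_point even_group p"
proof -
  have "(\<lambda>n. act (prefix s (2 * n)) 0) \<longlonglongrightarrow> p"
    by (rule filterlim_compose[OF act_prefix_tendsto[OF assms]])
       (auto intro!: filterlim_subseq strict_monoI)
  thus ?thesis unfolding limit_point_def using assms(2)
    by (intro conjI bexI[of _ 0] exI[of _ "\<lambda>n. restrict (act (prefix s (2 * n))) (cball 0 1)"])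
       (auto simp: codes_def intro!: act_in_even_group)
qed

text \<open>The set that is concentrated is the open upper half circle. A prefix of even length ends in an odd
  letter, whose cap lies below, and is followed by an even one, whose cap lies above.\<close>

lemma weak_concentration_if_coded:
  assumes parity: "\<And>n. even (s n) \<longleftrightarrow> even n" and p: "codes s p" and unb: "\<And>N. \<exists>k. N \<le> s k"
  shows "weak_concentration_point even_group p"
proof -
  have s: "s n \<noteq> s (Suc n)" for n using parity[of n] parity[of "Suc n"] by auto
  define U where "U = {z \<in> sphere 0 1. 0 < Im z}"
  have "connected U" using connected_circle_halfplane[of \<i> 0] by (simp add: U_def)
  moreover have "can_be_concentrated even_group U p"
    unfolding can_be_concentrated_def
  proof (intro conjI allI impI)
    have "openin (top_of_set (sphere 0 1)) (sphere 0 1 \<inter> {z. 0 < Im z})"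
      by (intro openin_open_Int open_halfspace_Im_gt)
    thus "openin (top_of_set (sphere 0 1)) U" by (simp add: U_def Int_def)
    fix V assume "circle_nbhd V p"
    then obtain e where e: "0 < e" "\<And>x. norm x = 1 \<Longrightarrow> dist x p < e \<Longrightarrow> x \<in> V"
      by (rule circle_nbhd_ball) blast
    obtain K where K: "\<And>n y. K < n \<Longrightarrow> norm y \<le> 1 \<Longrightarrow> y \<notin> open_cap (c (s (n - 1))) \<Longrightarrow>
        dist (act (prefix s n) y) p < e"
      using act_prefix_near[OF s p unb e(1)] by blast
    define n where "n = 2 * Suc K"
    have n: "K < n" "even n" "odd (n - 1)" by (auto simp: n_def)
    have img: "restrict (act (prefix s n)) (cball 0 1) ` U = act (prefix s n) ` U"
      by (rule image_restrict_subset) (auto simp: U_def)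
    show "\<exists>\<gamma>\<in>even_group. p \<in> \<gamma> ` U \<and> \<gamma> ` U \<subseteq> V"
    proof (intro bexI conjI)
      have "orbit s p n \<in> U"
        using p parity[of n] n even_cap_upper[of "s n" "orbit s p n"]
        by (auto simp: U_def codes_def orbit_eq_act norm_act_eq_1)
      hence "act (prefix s n) (orbit s p n) \<in> act (prefix s n) ` U" by (rule imageI)
      thus "p \<in> restrict (act (prefix s n)) (cball 0 1) ` U" by (simp only: img act_prefix_orbit)
      show "restrict (act (prefix s n)) (cball 0 1) ` U \<subseteq> V"
      proof (unfold img, safe)
        fix y assume y: "y \<in> U"
        have "y \<notin> open_cap (c (s (n - 1)))"
          using y odd_cap_lower[of "s (n - 1)" y] parity[of "n - 1"] n by (intro notin_open_capI) (auto simp: U_def)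
        thus "act (prefix s n) y \<in> V" using y n by (intro e(2) K norm_act_eq_1) (auto simp: U_def)
      qed
      show "restrict (act (prefix s n)) (cball 0 1) \<in> even_group" using n by (intro act_in_even_group) simp
    qed
  qed
  ultimately show ?thesis
    unfolding weak_concentration_point_def using limit_point_if_coded[OF s p unb] by blast
qed

lemma cylinder_neighbourhood:
  assumes p: "codes s p" and s: "\<And>n. s n \<noteq> s (Suc n)"
  shows "\<exists>d>0. \<forall>z. norm z \<le> 1 \<longrightarrow> dist z p < d \<longrightarrow> (\<forall>k<K. orbit s z k \<in> cap (c (s k)))"
proof (induction K)
  case 0
  show ?case by (intro exI[of _ 1]) simp
next
  case (Suc K)
  then obtain d where d: "0 < d" "\<And>z k. norm z \<le> 1 \<Longrightarrow> dist z p < d \<Longrightarrow> k < K \<Longrightarrow> orbit s z k \<in> cap (c (s k))"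
    by blast
  define T where "T = {x. (norm (x - c (s K)))\<^sup>2 < (norm (c (s K)))\<^sup>2 - 1}"
  have "open T" unfolding T_def by (intro open_Collect_less continuous_intros)
  moreover have "orbit s p K \<in> T" using orbit_in_open_cap[OF p s] by (auto simp: T_def open_cap_def)
  ultimately obtain e where e: "0 < e" "ball (orbit s p K) e \<subseteq> T" by (meson open_contains_ball)
  have "p \<in> cball 0 1" using p by (simp add: codes_def)
  moreover have "continuous_on (cball 0 1) (\<lambda>z. orbit s z K)"
    unfolding orbit_eq_act by (rule continuous_on_act)
  ultimately obtain d' where "0 < d'" "\<forall>z\<in>cball 0 1. dist z p < d' \<longrightarrow> dist (orbit s z K) (orbit s p K) < e"
    using e(1) unfolding continuous_on_iff by blast
  hence d': "0 < d'" "\<And>z. norm z \<le> 1 \<Longrightarrow> dist z p < d' \<Longrightarrow> dist (orbit s z K) (orbit s p K) < e" by auto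
  show ?case
  proof (intro exI[of _ "min d d'"] conjI allI impI)
    fix z k assume z: "norm z \<le> 1" "dist z p < min d d'" "k < Suc K"
    show "orbit s z k \<in> cap (c (s k))"
    proof (cases "k = K")
      case True
      have "orbit s z K \<in> T" using d'(2)[of z] z e(2) by (auto simp: dist_commute)
      thus ?thesis using True norm_orbit_le_1[OF z(1), of s K] by (auto simp: T_def cap_def)
    qed (use z d(2) in auto)
  qed (use d d' in auto)
qed

lemma caps_near_1:
  assumes "0 < e"
  shows "\<exists>N. \<forall>i\<ge>N. \<forall>z\<in>cap (c i). dist z 1 < e"
proof -
  have "(\<lambda>i. sqrt ((norm (c i))\<^sup>2 - 1) + dist (c i) 1) \<longlonglongrightarrow> 0 + dist 1 (1::complex)"
    by (intro tendsto_intros radii_to_0 centers_to_1)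
  hence "\<forall>\<^sub>F i in sequentially. sqrt ((norm (c i))\<^sup>2 - 1) + dist (c i) 1 < e"
    by (rule order_tendstoD(2)) (use assms in simp)
  then obtain N where N: "\<And>i. N \<le> i \<Longrightarrow> sqrt ((norm (c i))\<^sup>2 - 1) + dist (c i) 1 < e"
    by (auto simp: eventually_sequentially)
  have "dist z 1 < e" if "N \<le> i" "z \<in> cap (c i)" for i z
  proof -
    have "dist z (c i) \<le> sqrt ((norm (c i))\<^sup>2 - 1)"
      using that by (auto simp: cap_def dist_norm intro: real_le_rsqrt)
    thus ?thesis using N[OF that(1)] dist_triangle[of z 1 "c i"] by linarith
  qed
  thus ?thesis by blast
qed

lemma orbit_zero_in_cap:
  assumes s: "\<And>n. s n \<noteq> s (Suc n)" and "0 < n"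
  shows "orbit s 0 n \<in> cap (c (s (n - 1)))"
proof -
  have "prefix s n \<noteq> []" using assms(2) by (cases n) (auto simp: prefix_Suc)
  thus ?thesis
    using ping_pong[of "rev (prefix s n)" 0] distinct_adj_prefix[of s n, OF s] assms(2)
    by (auto simp: orbit_eq_act hd_rev last_prefix zero_notin_cap notin_open_capI)
qed

text \<open>If \<open>act w 0\<close> is close to \<open>p\<close>, then \<open>w\<close> agrees with \<open>s\<close> up to some large place \<open>m\<close>, taken as large as
  possible. Stripping off this common prefix moves 0 and \<open>p\<close> into caps close to 1. What
  remains of \<open>w\<close> is empty or starts with a letter that differs from the letters of both caps, so its
  inverse does not increase their distance.\<close>

lemma inverse_contracts_ray:
  assumes p: "codes s p" and s: "\<And>n. s n \<noteq> s (Suc n)" and lim: "filterlim s at_top sequentially"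
    and e: "0 < e"
  shows "\<exists>d>0. \<forall>w. distinct_adj w \<longrightarrow> dist (act w 0) p < d \<longrightarrow> dist (act (rev w) 0) (act (rev w) p) < e"
proof -
  obtain N where N: "\<And>i z. N \<le> i \<Longrightarrow> z \<in> cap (c i) \<Longrightarrow> dist z 1 < e / 2"
    using caps_near_1[of "e / 2"] e by auto
  have "\<forall>\<^sub>F n in sequentially. N \<le> s n" using lim by (simp add: filterlim_at_top)
  then obtain K where K: "\<And>n. K \<le> n \<Longrightarrow> N \<le> s n" by (auto simp: eventually_sequentially)
  obtain d where d: "0 < d" "\<And>z k. norm z \<le> 1 \<Longrightarrow> dist z p < d \<Longrightarrow> k < Suc K \<Longrightarrow> orbit s z k \<in> cap (c (s k))"
    using cylinder_neighbourhood[OF p s, of "Suc K"] by blast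
  have "dist (act (rev w) 0) (act (rev w) p) < e" if w: "distinct_adj w" "dist (act w 0) p < d" for w
  proof -
    have agree: "w ! k = s k" if "k < Suc K" "k < length w" for k
      by (rule reduced_word_follows_code[of w 0])
         (use w that d(2) zero_notin_cap notin_open_capI norm_act_le_1 in auto)
    have long: "Suc K \<le> length w"
    proof (rule ccontr)
      assume short: "\<not> Suc K \<le> length w"
      hence "w = prefix s (length w)" by (intro eq_prefixI agree) auto
      hence "orbit s (act w 0) (length w) = 0" by (metis orbit_act_prefix)
      thus False using d(2)[of "act w 0" "length w"] w short zero_notin_cap norm_act_le_1[of 0 w] by auto
    qed
    define m where "m = (LEAST k. k = length w \<or> w ! k \<noteq> s k)"
    have m: "m = length w \<or> w ! m \<noteq> s m" unfolding m_def by (rule LeastI[of _ "length w"]) simp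
    have m_le: "m \<le> length w" unfolding m_def by (rule Least_le) simp
    have before: "w ! k = s k" if "k < m" for k using not_less_Least[OF that[unfolded m_def]] by blast
    have Km: "Suc K \<le> m" using m agree[of m] long m_le by linarith
    define u where "u = drop m w"
    have "take m w = prefix s (length (take m w))" using before by (intro eq_prefixI) auto
    hence wu: "w = prefix s m @ u" using m_le unfolding u_def by (metis append_take_drop_id length_take min.absorb2)
    have a: "orbit s 0 m \<in> cap (c (s (m - 1)))" using Km by (intro orbit_zero_in_cap s) auto
    have x: "orbit s p m \<in> cap (c (s m))" using p by (simp add: codes_def)
    have hd: "hd u \<noteq> s m \<and> hd u \<noteq> s (m - 1)" if "u \<noteq> []"
    proof -
      have ml: "m < length w" using that by (auto simp: u_def)
      hence "hd u = w ! m" by (simp add: u_def hd_drop_conv_nth)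
      moreover have "w ! (m - 1) \<noteq> w ! m" using distinct_adj_nth[OF w(1), of "m - 1"] ml Km by simp
      ultimately show ?thesis using m ml before[of "m - 1"] Km by auto
    qed
    have "dist (act (rev w) 0) (act (rev w) p) = dist (act (rev u) (orbit s 0 m)) (act (rev u) (orbit s p m))"
      by (simp add: wu orbit_eq_act)
    also have "\<dots> \<le> dist (orbit s 0 m) (orbit s p m)"
    proof (rule act_nonexpanding)
      show "distinct_adj (rev u)" using w(1) wu by (metis distinct_adj_appendD2 distinct_adj_rev)
      show "orbit s 0 m \<notin> open_cap (c (last (rev u)))" if "rev u \<noteq> []"
        using that hd a notin_other_cap notin_open_capI by (metis last_rev rev_is_Nil_conv)
      show "orbit s p m \<notin> open_cap (c (last (rev u)))" if "rev u \<noteq> []"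
        using that hd x notin_other_cap notin_open_capI by (metis last_rev rev_is_Nil_conv)
    qed (use a x norm_le_1_if_cap in auto)
    also have "\<dots> \<le> dist (orbit s 0 m) 1 + dist (orbit s p m) 1" by (rule dist_triangle2)
    also have "\<dots> < e / 2 + e / 2"
      using Km by (intro add_strict_mono N[OF K a] N[OF K x]) auto
    finally show ?thesis by simp
  qed
  thus ?thesis using d(1) by blast
qed

lemma not_conical_if_code_diverges:
  assumes p: "codes s p" and s: "\<And>n. s n \<noteq> s (Suc n)" and lim: "filterlim s at_top sequentially"
  shows "\<not> conical_limit_point even_group p"
proof
  assume "conical_limit_point even_group p"
  moreover have "norm (g 0) < 1" if "g \<in> even_group" for g
    using that norm_act_less_1[of 0] by (auto simp: even_group_def)
  ultimately obtain \<gamma> M where \<gamma>: "\<And>n::nat. \<gamma> n \<in> even_group" "(\<lambda>n. \<gamma> n 0) \<longlonglongrightarrow> p"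
    and M: "\<forall>\<^sub>F n in sequentially. norm (\<gamma> n 0 - p) \<le> M * (1 - (norm (\<gamma> n 0))\<^sup>2)"
    using conical_limit_point_nontangential by blast
  \<comment> \<open>Any bound whose product with \<open>M\<close> is below 1 contradicts the distance identity.\<close>
  have "0 < 1 / (\<bar>M\<bar> + 1)" by simp
  then obtain d where d: "0 < d"
    "\<And>w. distinct_adj w \<Longrightarrow> dist (act w 0) p < d \<Longrightarrow> dist (act (rev w) 0) (act (rev w) p) < 1 / (\<bar>M\<bar> + 1)"
    using inverse_contracts_ray[OF p s lim] by blast
  have "\<forall>\<^sub>F n in sequentially. dist (\<gamma> n 0) p < d" using \<gamma>(2) d(1) by (rule tendstoD)
  hence "\<forall>\<^sub>F n in sequentially. dist (\<gamma> n 0) p < d \<and> norm (\<gamma> n 0 - p) \<le> M * (1 - (norm (\<gamma> n 0))\<^sup>2)"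
    using M by (rule eventually_conj)
  then obtain n where n: "dist (\<gamma> n 0) p < d" "norm (\<gamma> n 0 - p) \<le> M * (1 - (norm (\<gamma> n 0))\<^sup>2)"
    using eventually_happens'[OF sequentially_bot] by blast
  obtain v where v: "\<gamma> n = restrict (act v) (cball 0 1)" "even (length v)" using \<gamma>(1)[of n] by (auto simp: even_group_def)
  obtain w where w: "distinct_adj w" "even (length w)" "act w = act v" using exists_reduced_word[of v] v(2) by blast
  have \<gamma>0: "\<gamma> n 0 = act w 0" by (simp add: v w)
  define h where "h = 1 - (norm (act w 0))\<^sup>2"
  have h: "0 < h" unfolding h_def by (intro one_minus_norm_power2_pos norm_act_less_1) simp
  define \<rho> where "\<rho> = dist (act (rev w) 0) (act (rev w) p)"
  have "norm p = 1" using p by (simp add: codes_def)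
  hence "h = norm (act w 0 - p) * \<rho>" using act_distance_identity[OF w(2)] by (simp add: h_def \<rho>_def dist_norm)
  also have "\<dots> \<le> M * h * \<rho>" using n(2) by (intro mult_right_mono) (auto simp: \<gamma>0 h_def \<rho>_def)
  also have "\<dots> \<le> \<bar>M\<bar> * h * \<rho>" using h by (intro mult_right_mono) (auto simp: \<rho>_def)
  finally have "h * 1 \<le> h * (\<bar>M\<bar> * \<rho>)" by (simp add: mult_ac)
  hence "1 \<le> \<bar>M\<bar> * \<rho>" using h by (simp add: mult_le_cancel_left_pos)
  moreover have "\<bar>M\<bar> * \<rho> \<le> (\<bar>M\<bar> + 1) * \<rho>" by (simp add: \<rho>_def mult_right_mono)
  moreover have "(\<bar>M\<bar> + 1) * \<rho> < 1"
    using d(2)[OF w(1)] n(1) unfolding \<gamma>0 \<rho>_def[symmetric] by (simp add: field_simps)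
  ultimately show False by linarith
qed

text \<open>At even places the orbit of \<open>p\<close> is in one fixed cap, whereas the orbit of 0 has just been reflected
  into a cap close to 1.\<close>

lemma conical_if_code_returns:
  assumes p: "codes s p" and s: "\<And>n. s n \<noteq> s (Suc n)"
    and even: "\<And>n. s (2 * n) = i" and lim: "filterlim (\<lambda>n. s (2 * n + 1)) at_top sequentially"
  shows "conical_limit_point even_group p"
proof -
  have unb: "\<exists>k. N \<le> s k" for N
    using lim by (auto simp: filterlim_at_top eventually_sequentially)
  have "1 \<notin> cap (c i)" by (rule real_notin_cap) simp
  then obtain \<delta> where \<delta>: "0 < \<delta>" "\<And>x. x \<in> cap (c i) \<Longrightarrow> \<delta> \<le> dist 1 x"
    using separate_point_closed[OF compact_imp_closed[OF convex_compact_cap(2)]] by metis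
  obtain N where N: "\<And>j z. N \<le> j \<Longrightarrow> z \<in> cap (c j) \<Longrightarrow> dist z 1 < \<delta> / 2"
    using caps_near_1[of "\<delta> / 2"] \<delta>(1) by auto
  have "\<forall>\<^sub>F n in sequentially. N \<le> s (2 * n + 1)" using lim by (simp add: filterlim_at_top)
  then obtain K where K: "\<And>n. K \<le> n \<Longrightarrow> N \<le> s (2 * n + 1)" by (auto simp: eventually_sequentially)
  define v where "v = (\<lambda>n. prefix s (2 * (n + Suc K)))"
  have "norm (act (v n) 0 - p) \<le> 2 / \<delta> * (1 - (norm (act (v n) 0))\<^sup>2)" for n
  proof -
    define m where "m = 2 * (n + Suc K)"
    have m: "0 < m" "m - 1 = 2 * (n + K) + 1" by (auto simp: m_def)
    have "orbit s 0 m \<in> cap (c (s (m - 1)))" by (intro orbit_zero_in_cap s m)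
    moreover have "N \<le> s (m - 1)" unfolding m(2) by (rule K) simp
    ultimately have "dist (orbit s 0 m) 1 < \<delta> / 2" by (intro N)
    moreover have "orbit s p m \<in> cap (c i)"
      using p even[of "n + Suc K"] unfolding codes_def m_def by metis
    ultimately have "\<delta> / 2 \<le> dist (orbit s 0 m) (orbit s p m)"
      using \<delta>(2)[of "orbit s p m"] dist_triangle[of 1 "orbit s p m" "orbit s 0 m"]
      by (simp add: dist_commute)
    hence "norm (act (v n) 0 - p) * (\<delta> / 2) \<le> norm (act (v n) 0 - p) * dist (orbit s 0 m) (orbit s p m)"
      by (rule mult_left_mono) simp
    also have "\<dots> = 1 - (norm (act (v n) 0))\<^sup>2"
      using act_distance_identity[of "v n" p] p by (simp add: v_def m_def codes_def orbit_eq_act dist_norm)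
    finally show ?thesis using \<delta>(1) by (simp add: field_simps)
  qed
  moreover have "(\<lambda>n. act (v n) 0) \<longlonglongrightarrow> p"
    unfolding v_def by (rule filterlim_compose[OF act_prefix_tendsto[OF s p unb]])
      (auto intro!: filterlim_subseq strict_monoI)
  ultimately show ?thesis
    using norm_act_less_1[of 0]
    by (intro conical_limit_pointI[where \<gamma> = "\<lambda>n. restrict (act (v n)) (cball 0 1)" and M = "2 / \<delta>"]
        limit_point_if_coded[OF s p unb] act_in_even_group) (auto simp: v_def)
qed

lemma open_cap_sphere_preimage:
  "act w ` (open_cap (c j) \<inter> sphere 0 1) = {z \<in> sphere 0 1. act (rev w) z \<in> open_cap (c j)}"
proof safe
  fix z assume z: "z \<in> sphere 0 1" "act (rev w) z \<in> open_cap (c j)"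
  hence "act w (act (rev w) z) \<in> act w ` (open_cap (c j) \<inter> sphere 0 1)"
    by (intro imageI) (auto simp: norm_act_eq_1)
  thus "z \<in> act w ` (open_cap (c j) \<inter> sphere 0 1)" by simp
qed (auto simp: norm_act_eq_1)

text \<open>If the reduced word of \<open>f\<close> ends in \<open>s m\<close>, its inverse sends -1 into the cap of that letter by
  ping-pong. Otherwise that word is a prefix of the code of \<open>p\<close>, followed by \<open>s m\<close>, and there is only one
  place where this letter occurs.\<close>

lemma cylinder_dichotomy:
  assumes p: "codes s p" and once: "\<And>k. s k = s m \<Longrightarrow> k = m"
    and f: "act (rev f) p \<in> cap (c (s m))"
  shows "act f = act (prefix s m) \<or> act (rev f) (-1) \<in> open_cap (c (s m))"
proof -
  obtain v where v: "distinct_adj v" "act v = act f" using exists_reduced_word by blast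
  have inv: "act (rev v) = act (rev f)"
    using v(2) by (metis act_act_rev act_rev_act ext)
  show ?thesis
  proof (cases "v \<noteq> [] \<and> last v = s m")
    case True
    hence "act (rev v) (-1) \<in> open_cap (c (hd (rev v)))"
      using v(1) real_notin_cap[of "-1"] by (intro ping_pong_open) auto
    thus ?thesis using True inv by (simp add: hd_rev)
  next
    case False
    have "v ! k = s k" if "k < length v" for k
    proof (rule reduced_word_follows_code[OF v(1) _ _ that])
      show "norm (act (rev v) p) \<le> 1" using p by (simp add: norm_act_eq_1 codes_def)
      show "act (rev v) p \<notin> open_cap (c (last v))" if "v \<noteq> []"
        using f False that by (metis inv notin_open_capI notin_other_cap)
      show "orbit s (act v (act (rev v) p)) l \<in> cap (c (s l))" for l using p by (simp add: codes_def)
    qed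
    hence v_eq: "v = prefix s (length v)" by (rule eq_prefixI)
    have "act (rev v) p \<in> cap (c (s (length v)))"
      using p v_eq by (metis codes_def orbit_eq_act)
    hence "s (length v) = s m" using f by (metis inv same_cap)
    hence "length v = m" by (rule once)
    thus ?thesis using v(2) v_eq by metis
  qed
qed

text \<open>The small neighborhoods of \<open>p\<close> are the arcs \<open>U\<close> at infinity of the cylinders ending in a letter that
  occurs once. By the preceding dichotomy a translate of \<open>U\<close>, or of the complementary arc \<open>E\<close>, that
  contains \<open>p\<close> also contains -1 or one particular point \<open>q\<close>. A neighborhood of \<open>p\<close> avoiding these two
  points therefore excludes concentration.\<close>

lemma not_geodesic_separation_if_once:
  assumes p: "codes s p" and s: "\<And>n. s n \<noteq> s (Suc n)" and unb: "\<And>N. \<exists>k. N \<le> s k"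
    and once: "\<And>N. \<exists>m\<ge>N. \<forall>k. s k = s m \<longrightarrow> k = m"
  shows "\<not> geodesic_separation_point even_group p"
proof
  assume "geodesic_separation_point even_group p"
  then obtain W where W: "circle_nbhd W p" and sep: "\<And>U. circle_nbhd U p \<Longrightarrow> connected U \<Longrightarrow> U \<subseteq> W \<Longrightarrow>
      can_be_concentrated even_group U p \<or> can_be_concentrated even_group (sphere 0 1 - closure U) p"
    by (auto simp: geodesic_separation_point_def)
  have p1: "norm p = 1" using p by (simp add: codes_def)
  from W obtain e where e: "0 < e" "\<And>x. norm x = 1 \<Longrightarrow> dist x p < e \<Longrightarrow> x \<in> W"
    by (rule circle_nbhd_ball) blast
  obtain K where K: "\<And>n y. K < n \<Longrightarrow> norm y \<le> 1 \<Longrightarrow> y \<notin> open_cap (c (s (n - 1))) \<Longrightarrow>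
      dist (act (prefix s n) y) p < e"
    using act_prefix_near[OF s p unb e(1)] by blast
  obtain m where m: "Suc K \<le> m" "\<And>k. s k = s m \<Longrightarrow> k = m" using once by blast
  define j where "j = s m"
  define g where "g = prefix s m"
  define U where "U = act g ` (open_cap (c j) \<inter> sphere 0 1)"
  have U_eq: "U = {z \<in> sphere 0 1. act (rev g) z \<in> open_cap (c j)}"
    unfolding U_def by (rule open_cap_sphere_preimage)
  have "openin (top_of_set (sphere 0 1)) U"
  proof -
    have "continuous_on (sphere 0 1) (act (rev g))"
      by (rule continuous_on_subset[OF continuous_on_act]) auto
    moreover have "open {x. (norm (x - c j))\<^sup>2 < (norm (c j))\<^sup>2 - 1}"
      by (intro open_Collect_less continuous_intros)
    ultimately have "openin (top_of_set (sphere 0 1))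
        (sphere 0 1 \<inter> act (rev g) -` {x. (norm (x - c j))\<^sup>2 < (norm (c j))\<^sup>2 - 1})"
      by (rule continuous_openin_preimage_gen)
    also have "sphere 0 1 \<inter> act (rev g) -` {x. (norm (x - c j))\<^sup>2 < (norm (c j))\<^sup>2 - 1} = U"
      by (auto simp: U_eq open_cap_def norm_act_eq_1)
    finally show ?thesis .
  qed
  moreover have pU: "p \<in> U"
    using orbit_in_open_cap[OF p s, of m] p1 by (simp add: U_eq g_def j_def orbit_eq_act)
  ultimately have nbhd: "circle_nbhd U p" by (simp add: circle_nbhd_def)
  have conn: "connected U" unfolding U_def
    by (intro connected_continuous_image connected_open_arc norm_center
          continuous_on_subset[OF continuous_on_act]) (auto simp: open_cap_def)
  have UW: "U \<subseteq> W"
  proof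
    fix x assume "x \<in> U"
    then obtain y where y: "x = act g y" "y \<in> open_cap (c j)" "norm y = 1" by (auto simp: U_def)
    have "y \<in> cap (c j)" using y open_cap_subset_cap by blast
    moreover have "j \<noteq> s (m - 1)" using s[of "m - 1"] m(1) by (simp add: j_def)
    ultimately have "y \<notin> open_cap (c (s (m - 1)))" by (intro notin_open_capI notin_other_cap)
    thus "x \<in> W" using y m(1) unfolding y(1) g_def by (intro e(2) K norm_act_eq_1) auto
  qed
  have clU: "closure U \<subseteq> act g ` cap (c j)"
  proof (rule closure_minimal)
    show "U \<subseteq> act g ` cap (c j)" using open_cap_subset_cap by (auto simp: U_def)
    have "continuous_on (cap (c j)) (act g)"
      by (rule continuous_on_subset[OF continuous_on_act cap_subset_disc])
    thus "closed (act g ` cap (c j))"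
      by (intro compact_imp_closed compact_continuous_image convex_compact_cap)
  qed
  define E where "E = sphere 0 1 - closure U"
  have U_sphere: "U \<subseteq> cball 0 1" "E \<subseteq> cball 0 1" by (auto simp: U_eq E_def)
  have E_I: "z \<in> E" if "norm z = 1" "act (rev g) z \<notin> cap (c j)" for z
    using that clU by (auto simp: E_def)
  have E_D: "reflection (c j) (act (rev g) z) \<in> cap (c j)" if "z \<in> E" for z
  proof -
    have "norm z = 1" "z \<notin> U" using that closure_subset by (auto simp: E_def)
    thus ?thesis by (intro reflection_into_cap norm_center) (auto simp: U_eq norm_act_eq_1)
  qed
  define b :: complex where "b = -1"
  have b: "norm b = 1" "b \<notin> cap (c i)" for i using real_notin_cap[of "-1"] by (auto simp: b_def)
  define q where "q = act g (reflection (c j) b)"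
  \<comment> \<open>The point \<open>q\<close> covers the case where the translate is fixed, \<open>b\<close> all other translates.\<close>
  define V where "V = sphere 0 1 - {b, q}"
  have "p \<noteq> b" using p b(2) by (metis codes_def orbit.simps(1))
  moreover have "p \<noteq> q"
  proof
    assume "p = q"
    hence "orbit s p (Suc m) = b" by (simp add: q_def g_def j_def norm_center)
    thus False using p b(2) by (metis codes_def)
  qed
  moreover have "openin (top_of_set (sphere 0 1)) V"
    unfolding V_def Diff_eq by (intro openin_open_Int open_Compl finite_imp_closed) simp
  ultimately have V: "circle_nbhd V p" using p1 by (simp add: circle_nbhd_def V_def)
  have dich: "act f = act g \<or> act (rev f) b \<in> open_cap (c j)" if "act (rev f) p \<in> cap (c j)" for f
    using cylinder_dichotomy[OF p m(2)] that by (simp add: j_def g_def b_def)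
  have \<rho>b: "reflection (c j) b \<in> open_cap (c j)" using b by (intro reflection_into_open_cap norm_center) auto
  have "\<not> can_be_concentrated even_group U p"
  proof
    assume "can_be_concentrated even_group U p"
    then obtain h where h: "h \<in> even_group" "p \<in> h ` U" "h ` U \<subseteq> V" using V by (auto simp: can_be_concentrated_def)
    obtain u where hu: "h = restrict (act u) (cball 0 1)" using h(1) by (auto simp: even_group_def)
    have "h ` U = act u ` U" unfolding hu by (rule image_restrict_subset[OF U_sphere(1)])
    hence u: "p \<in> act u ` U" "act u ` U \<subseteq> V" using h by (simp_all only:)
    have "act (rev (u @ g)) p \<in> cap (c j)" using u(1) by (auto simp: U_eq intro: subsetD[OF open_cap_subset_cap])
    thus False
    proof (rule disjE[OF dich])
      assume eq: "act (u @ g) = act g"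
      have "act g (reflection (c j) b) \<in> U"
        unfolding U_def using \<rho>b b norm_reflection_eq_1[OF norm_center] by (intro imageI) auto
      hence "act u (act g (reflection (c j) b)) \<in> V" using u(2) by blast
      thus False using eq by (simp add: V_def q_def flip: act_append)
    next
      assume "act (rev (u @ g)) b \<in> open_cap (c j)"
      hence "act (rev u) b \<in> U" using b by (simp add: U_eq norm_act_eq_1)
      hence "act u (act (rev u) b) \<in> V" using u(2) by blast
      thus False by (simp add: V_def)
    qed
  qed
  moreover have "\<not> can_be_concentrated even_group E p"
  proof
    assume "can_be_concentrated even_group E p"
    then obtain h where h: "h \<in> even_group" "p \<in> h ` E" "h ` E \<subseteq> V" using V by (auto simp: can_be_concentrated_def)
    obtain u where hu: "h = restrict (act u) (cball 0 1)" using h(1) by (auto simp: even_group_def)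
    have "h ` E = act u ` E" unfolding hu by (rule image_restrict_subset[OF U_sphere(2)])
    hence u: "p \<in> act u ` E" "act u ` E \<subseteq> V" using h by (simp_all only:)
    \<comment> \<open>The additional letter \<open>j\<close> reflects the outside of the cap, where \<open>E\<close> comes from, into the cap.\<close>
    have "act (rev (u @ g @ [j])) p \<in> cap (c j)" using u(1) E_D by auto
    thus False
    proof (rule disjE[OF dich])
      assume eq: "act (u @ g @ [j]) = act g"
      have "act g b \<in> E" using b by (intro E_I) (auto simp: norm_act_eq_1)
      hence "act u (act g b) \<in> V" using u(2) by blast
      moreover have "q = act (u @ g @ [j]) (reflection (c j) b)" by (simp only: eq q_def)
      hence "act u (act g b) = q" by (simp add: norm_center)
      ultimately show False by (simp add: V_def)
    next
      assume "act (rev (u @ g @ [j])) b \<in> open_cap (c j)"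
      hence "act (rev g) (act (rev u) b) \<notin> cap (c j)"
        using reflection_of_open_cap[OF norm_center] norm_center by fastforce
      hence "act (rev u) b \<in> E" using b by (intro E_I) (auto simp: norm_act_eq_1)
      hence "act u (act (rev u) b) \<in> V" using u(2) by blast
      thus False by (simp add: V_def)
    qed
  qed
  ultimately show False using sep[OF nbhd conn UW] by (simp add: E_def)
qed

end

section \<open>A system of caps accumulating at 1 and the codes used on it\<close>

text \<open>The cap around \<open>alternating_center k\<close> has endpoints \<open>e\<^sup>i\<^sup>\<theta>\<close> with \<open>tan (\<theta> / 2)\<close> equal to
  \<open>1 / (2 k + 1)\<close> and \<open>1 / (2 k + 2)\<close> up to the common sign \<open>(-1)\<^sup>k\<close>; its center is the pole of the chord
  between them.\<close>

definition alternating_center :: "nat \<Rightarrow> complex" where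
  "alternating_center k =
     (let m = real ((2 * k + 1) * (2 * k + 2))
      in Complex ((m - 1) / (m + 1)) ((-1) ^ k * (4 * real k + 3) / (m + 1)))"

lemma norm_alternating_center: "1 < norm (alternating_center k)"
proof -
  define m where "m = real ((2 * k + 1) * (2 * k + 2))"
  have "0 < m" unfolding m_def of_nat_0_less_iff by simp
  hence m: "0 < m + 1" by simp
  have m4: "4 * m + 1 = (4 * real k + 3)\<^sup>2"
    by (simp add: m_def power2_eq_square algebra_simps)
  have sign: "((-1) ^ k)\<^sup>2 = (1::real)" by (cases "even k") auto
  have "(norm (alternating_center k))\<^sup>2 = ((m - 1) / (m + 1))\<^sup>2 + ((4 * real k + 3) / (m + 1))\<^sup>2"
    unfolding cmod_power2 alternating_center_def Let_def m_def[symmetric] complex.sel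
    by (simp add: power_mult_distrib power_divide sign)
  also have "\<dots> = ((m - 1)\<^sup>2 + (4 * m + 1)) / (m + 1)\<^sup>2"
    unfolding m4 power_divide by (rule add_divide_distrib[symmetric])
  also have "(m - 1)\<^sup>2 + (4 * m + 1) = (m + 1)\<^sup>2 + 1" by (simp add: power2_eq_square algebra_simps)
  also have "((m + 1)\<^sup>2 + 1) / (m + 1)\<^sup>2 > 1" using m by simp
  finally have "1\<^sup>2 < (norm (alternating_center k))\<^sup>2" by simp
  thus ?thesis by (rule power2_less_imp_less) simp
qed

text \<open>The quotient \<open>2 Im z / (norm (1 + z))\<^sup>2\<close> is the real part of the half-plane coordinate
  \<open>\<i> (1 - z) / (1 + z)\<close>, in which the cap is a half disc over an interval of the real axis. The
  inequalities say that this coordinate lies over the interval, and so separate the caps.\<close>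

lemma alternating_cap:
  assumes "z \<in> cap (alternating_center k)"
  defines "Q \<equiv> (norm (1 + z))\<^sup>2" and "Y \<equiv> 2 * ((-1) ^ k * Im z)"
  shows "0 < Y" "(2 * real k + 1) * Y \<le> Q" "Q \<le> (2 * real k + 2) * Y"
proof -
  define m where "m = real ((2 * k + 1) * (2 * k + 2))"
  have m: "0 < m" unfolding m_def of_nat_0_less_iff by simp
  define P where "P = (norm (1 - z))\<^sup>2"
  have PQ: "P = 1 + (norm z)\<^sup>2 - 2 * Re z" "Q = 1 + (norm z)\<^sup>2 + 2 * Re z"
    unfolding P_def Q_def cmod_power2 by (auto simp: power2_eq_square algebra_simps)
  have nonneg: "0 \<le> P" "0 \<le> Q" by (auto simp: P_def Q_def)
  have "1 + (norm z)\<^sup>2 \<le> 2 * (Re z * ((m - 1) / (m + 1)) + Im z * ((-1) ^ k * (4 * real k + 3) / (m + 1)))"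
    using assms(1) unfolding cap_alt alternating_center_def Let_def m_def[symmetric] by simp
  also have "\<dots> = (2 * Re z * (m - 1) + Y * (4 * real k + 3)) / (m + 1)"
  proof -
    have "2 * (x * (A / N) + y * (e * B / N)) = (2 * x * A + 2 * (e * y) * B) / N" for x y A B e N :: real
      by (simp add: add_divide_distrib algebra_simps)
    thus ?thesis unfolding Y_def .
  qed
  finally have "(1 + (norm z)\<^sup>2) * (m + 1) \<le> 2 * Re z * (m - 1) + Y * (4 * real k + 3)"
    using m by (simp add: pos_le_divide_eq)
  hence main: "m * P + Q \<le> (4 * real k + 3) * Y" unfolding PQ by (simp add: algebra_simps)
  show Y: "0 < Y"
  proof -
    have "0 < m * P + Q"
    proof (cases "Q = 0")
      case True
      hence "0 < P" using PQ zero_le_power2[of "norm z"] by linarith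
      thus ?thesis using m True by simp
    next
      case False
      thus ?thesis using nonneg m mult_nonneg_nonneg[of m P] by linarith
    qed
    hence "0 < (4 * real k + 3) * Y" using main by linarith
    thus ?thesis by (simp add: zero_less_mult_iff)
  qed
  have "P * Q - Y\<^sup>2 = (1 - (norm z)\<^sup>2)\<^sup>2"
  proof -
    have "Y\<^sup>2 = 4 * (Im z)\<^sup>2" by (cases "even k") (simp_all add: Y_def power_mult_distrib)
    moreover have "P * Q = (1 + (norm z)\<^sup>2)\<^sup>2 - 4 * (Re z)\<^sup>2"
      unfolding PQ by (simp add: power2_eq_square algebra_simps)
    moreover have "(1 - (norm z)\<^sup>2)\<^sup>2 = (1 + (norm z)\<^sup>2)\<^sup>2 - 4 * (norm z)\<^sup>2"
      by (simp add: power2_eq_square algebra_simps)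
    ultimately show ?thesis by (simp add: cmod_power2)
  qed
  hence "Y\<^sup>2 \<le> P * Q" using zero_le_power2[of "1 - (norm z)\<^sup>2"] by linarith
  hence "m * Y\<^sup>2 + Q * Q \<le> m * (P * Q) + Q * Q" using m by simp
  also have "\<dots> = (m * P + Q) * Q" by (simp add: algebra_simps)
  also have "\<dots> \<le> ((4 * real k + 3) * Y) * Q" using main nonneg by (intro mult_right_mono)
  finally have "(Q - (2 * real k + 1) * Y) * (Q - (2 * real k + 2) * Y) \<le> 0"
    by (simp add: m_def power2_eq_square algebra_simps)
  moreover have "Q - (2 * real k + 2) * Y \<le> Q - (2 * real k + 1) * Y" using Y by (simp add: algebra_simps)
  ultimately show "(2 * real k + 1) * Y \<le> Q" "Q \<le> (2 * real k + 2) * Y"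
    by (auto simp: mult_le_0_iff)
qed

interpretation alternating: cap_system alternating_center
proof
  show "1 < norm (alternating_center i)" for i by (rule norm_alternating_center)
  show upper: "0 < Im z" if "even i" "z \<in> cap (alternating_center i)" for i z
    using alternating_cap(1)[OF that(2)] that(1) by simp
  show lower: "Im z < 0" if "odd i" "z \<in> cap (alternating_center i)" for i z
    using alternating_cap(1)[OF that(2)] that(1) by simp
  have "cap (alternating_center i) \<inter> cap (alternating_center j) = {}" if "i < j" for i j
  proof (rule ccontr)
    assume "\<not> ?thesis"
    then obtain z where z: "z \<in> cap (alternating_center i)" "z \<in> cap (alternating_center j)" by blast
    define Y where "Y = 2 * ((-1) ^ i * Im z)"
    have Y: "0 < Y" "Y = 2 * ((-1) ^ j * Im z)"
      using alternating_cap(1)[OF z(1)] upper lower z by (auto simp: Y_def)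
         (cases "even i"; cases "even j"; fastforce)
    have "(2 * real j + 1) * Y \<le> (2 * real i + 2) * Y"
      by (rule order_trans[OF alternating_cap(2)[OF z(2), folded Y(2)] alternating_cap(3)[OF z(1), folded Y_def]])
    moreover have "(2 * real i + 2) * Y < (2 * real j + 1) * Y"
      using Y(1) that by (intro mult_strict_right_mono) auto
    ultimately show False by simp
  qed
  thus "cap (alternating_center i) \<inter> cap (alternating_center j) = {}" if "i \<noteq> j" for i j
    using that by (cases i j rule: linorder_cases) (auto simp: Int_commute)
  have "(\<lambda>k. (4 * real k + 3) / (real ((2 * k + 1) * (2 * k + 2)) + 1)) \<longlonglongrightarrow> 0" by real_asymp
  hence "(\<lambda>k. (-1) ^ k * (4 * real k + 3) / (real ((2 * k + 1) * (2 * k + 2)) + 1)) \<longlonglongrightarrow> 0"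
    by (rule Lim_null_comparison[rotated]) (simp add: abs_mult)
  moreover have "(\<lambda>k. (real ((2 * k + 1) * (2 * k + 2)) - 1) / (real ((2 * k + 1) * (2 * k + 2)) + 1)) \<longlonglongrightarrow> 1"
    by real_asymp
  ultimately have "alternating_center \<longlonglongrightarrow> Complex 1 0"
    unfolding alternating_center_def Let_def by (intro tendsto_Complex)
  thus "alternating_center \<longlonglongrightarrow> 1" by (simp add: one_complex.code)
qed

text \<open>The values at place \<open>n\<close> lie in \<open>{4 n..4 n + 3}\<close> and have the parity of \<open>n\<close>, which leaves exactly one
  free bit per place.\<close>

definition escaping_code :: "(nat \<Rightarrow> bool) \<Rightarrow> nat \<Rightarrow> nat" where
  "escaping_code b n = 4 * n + (if b n then 2 else 0) + n mod 2"

lemma escaping_code_parity: "even (escaping_code b n) \<longleftrightarrow> even n"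
  by (simp add: escaping_code_def)

lemma escaping_code_at_top: "filterlim (escaping_code b) at_top sequentially"
  by (rule filterlim_at_top_mono[OF filterlim_ident]) (simp add: escaping_code_def)

lemma inj_escaping_code: "inj escaping_code"
proof (rule injI)
  show "b = b'" if eq: "escaping_code b = escaping_code b'" for b b'
  proof
    show "b n = b' n" for n using fun_cong[OF eq, of n] by (simp add: escaping_code_def split: if_splits)
  qed
qed

text \<open>The bit chooses between the letters \<open>n\<close> and \<open>n + 1\<close> at the odd place \<open>n\<close>; the choices at different
  odd places never collide.\<close>

definition returning_code :: "(nat \<Rightarrow> bool) \<Rightarrow> nat \<Rightarrow> nat" where
  "returning_code b n = (if even n then 0 else n + (if b (n div 2) then 1 else 0))"

lemma returning_code_adjacent: "returning_code b n \<noteq> returning_code b (Suc n)"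
  by (auto simp: returning_code_def odd_pos)

lemma returning_code_at_top: "filterlim (\<lambda>n. returning_code b (2 * n + 1)) at_top sequentially"
  by (rule filterlim_at_top_mono[OF filterlim_ident]) (simp add: returning_code_def)

lemma returning_code_once:
  assumes "odd m" "returning_code b k = returning_code b m"
  shows "k = m"
proof -
  have "odd k" using assms by (auto simp: returning_code_def split: if_splits)
  then obtain i j where "k = 2 * i + 1" "m = 2 * j + 1" using assms(1) by (auto elim!: oddE)
  thus ?thesis using assms(2) by (simp add: returning_code_def split: if_splits)
qed

lemma inj_returning_code: "inj returning_code"
proof (rule injI)
  show "b = b'" if eq: "returning_code b = returning_code b'" for b b'
  proof
    show "b n = b' n" for n
      using fun_cong[OF eq, of "2 * n + 1"] by (simp add: returning_code_def split: if_splits)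
  qed
qed

lemma uncountable_nat_bool: "uncountable (UNIV :: (nat \<Rightarrow> bool) set)"
  unfolding uncountable_def
proof (intro conjI notI)
  assume "\<exists>f :: nat \<Rightarrow> nat \<Rightarrow> bool. range f = UNIV"
  then obtain f :: "nat \<Rightarrow> nat \<Rightarrow> bool" where f: "range f = UNIV" by blast
  have "(\<lambda>n. \<not> f n n) \<in> range f" unfolding f by simp
  then obtain k where "(\<lambda>n. \<not> f n n) = f k" by blast
  from fun_cong[OF this, of k] show False by simp
qed simp

lemma (in cap_system) uncountable_coded:
  fixes S :: "(nat \<Rightarrow> bool) \<Rightarrow> nat \<Rightarrow> nat"
  assumes inj: "inj S" and adj: "\<And>b n. S b n \<noteq> S b (Suc n)"
    and Q: "\<And>b p. codes (S b) p \<Longrightarrow> Q p"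
  shows "uncountable {p. Q p}"
proof
  assume countable: "countable {p. Q p}"
  have "\<exists>p. codes (S b) p" for b by (rule code_exists) (rule adj)
  then obtain \<pi> where \<pi>: "\<And>b. codes (S b) (\<pi> b)" by metis
  have "inj \<pi>"
  proof (rule injI)
    fix b b' assume "\<pi> b = \<pi> b'"
    hence "S b = S b'" using \<pi> code_unique by metis
    thus "b = b'" using inj by (simp add: inj_eq)
  qed
  moreover have "countable (range \<pi>)"
    by (rule countable_subset[OF _ countable]) (use \<pi> Q in auto)
  ultimately show False using uncountable_nat_bool countable_image_inj_on by blast
qed

theorem proposition5p1:
  shows "\<exists>\<Gamma>. fuchsian_group \<Gamma> \<and> \<not> finitely_generated \<Gamma> \<and> (\<forall>g\<in>\<Gamma>. \<not> parabolic g) \<and>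
    uncountable {p. weak_concentration_point \<Gamma> p \<and> \<not> conical_limit_point \<Gamma> p} \<and>
    uncountable {p. conical_limit_point \<Gamma> p \<and> \<not> geodesic_separation_point \<Gamma> p}"
proof (intro exI[of _ "alternating.even_group"] conjI)
  show "fuchsian_group alternating.even_group" by (rule alternating.fuchsian_group)
  show "\<not> finitely_generated alternating.even_group" by (rule alternating.not_finitely_generated)
  show "\<forall>g\<in>alternating.even_group. \<not> parabolic g" using alternating.not_parabolic by blast
  have adj: "escaping_code b n \<noteq> escaping_code b (Suc n)" for b n
    using escaping_code_parity[of b n] escaping_code_parity[of b "Suc n"] by auto
  have unb: "\<exists>k. N \<le> escaping_code b k" for b N
    by (intro exI[of _ N]) (simp add: escaping_code_def)
  show "uncountable {p. weak_concentration_point alternating.even_group p \<and> \<not> conical_limit_point alternating.even_group p}"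
  proof (rule alternating.uncountable_coded[OF inj_escaping_code adj,
        where Q = "\<lambda>p. weak_concentration_point alternating.even_group p \<and> \<not> conical_limit_point alternating.even_group p"])
    fix b p assume p: "alternating.codes (escaping_code b) p"
    show "weak_concentration_point alternating.even_group p \<and> \<not> conical_limit_point alternating.even_group p"
      using alternating.weak_concentration_if_coded[OF escaping_code_parity p unb]
        alternating.not_conical_if_code_diverges[OF p adj escaping_code_at_top] by (rule conjI)
  qed
  have unb: "\<exists>k. N \<le> returning_code b k" for b N
    by (intro exI[of _ "2 * N + 1"]) (simp add: returning_code_def)
  have once: "\<exists>m\<ge>N. \<forall>k. returning_code b k = returning_code b m \<longrightarrow> k = m" for b N
    by (intro exI[of _ "2 * N + 1"]) (auto intro: returning_code_once)
  have zero: "returning_code b (2 * n) = 0" for b n by (simp add: returning_code_def)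
  show "uncountable {p. conical_limit_point alternating.even_group p \<and> \<not> geodesic_separation_point alternating.even_group p}"
  proof (rule alternating.uncountable_coded[OF inj_returning_code returning_code_adjacent,
        where Q = "\<lambda>p. conical_limit_point alternating.even_group p \<and> \<not> geodesic_separation_point alternating.even_group p"])
    fix b p assume p: "alternating.codes (returning_code b) p"
    show "conical_limit_point alternating.even_group p \<and> \<not> geodesic_separation_point alternating.even_group p"
      using alternating.conical_if_code_returns[OF p returning_code_adjacent zero returning_code_at_top]
        alternating.not_geodesic_separation_if_once[OF p returning_code_adjacent unb once] by (rule conjI)
  qed
qed

end
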